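(* Let $0\le t_1<T<\infty$. Then the function $s\mapsto \int_{0}^{T-t_1}b(t_1-s,\tau)\,d\tau$ belongs to $\mathcal{H}_{(-\infty,t_1]}(X)$, and $$P_{(-\infty,t_1]}X(T)=X(t_1)+\int_{-\infty}^{t_1}\left\{\int_{0}^{T-t_1}b(t_1-s,\tau)\,d\tau\right\}dX(s).$$
   Context: Setting. $(W(t):t\in\mathbf{R})$ is a one-dimensional standard Brownian motion with $W(0)=0$ on a probability space $(\Omega,\mathcal{F},P)$. $\nu$ is a Borel measure on $(0,\infty)$ with $\int_0^\infty (1+s)^{-1}\nu(ds)<\infty$. Put $c(t):=\int_0^\infty e^{-ts}\nu(ds)$ for $t>0$, $c(t):=0$ for $t\le 0$, and $g(t):=\int_0^t c(s)\,ds$ for $t\in\mathbf{R}$. Assume $\lim_{t\to0+}c(t)=\infty$, $\int_1^\infty c(t)^2dt<\infty$ and $\lim_{t\to\infty}g(t)=\infty$. The centered Gaussian process with stationary increments $(X(t):t\in\mathbf{R})$ is $X(t)=\int_{-\infty}^\infty\{g(t-s)-g(-s)\}\,dW(s)$. Projections. $M(X)$ is the real Hilbert space spanned by $\{X(t):t\in\mathbf{R}\}$ in $L^2(\Omega,\mathcal{F},P)$. For a closed interval $I$ of $\mathbf{R}$, $M_I(X)$ is the closed subspace spanned by $\{X(t):t\in I\}$, and $P_I$ is the orthogonal projection of $M(X)$ onto $M_I(X)$. AR coefficient and kernel $b$. There is a unique Borel measure $\mu$ on $(0,\infty)$ with $\int_0^\infty(1+s)^{-1}\mu(ds)<\infty$,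 $\mu(0,\infty)=\infty$, $\int_0^\infty s^{-1}\mu(ds)=\infty$ such that, with $\alpha(t):=\int_0^\infty e^{-st}\mu(ds)$ $(t>0)$, one has $-iz\{\int_0^\infty e^{izt}c(t)dt\}\{\int_0^\infty e^{izt}\alpha(t)dt\}=1$ for $\Im z>0$. Put $a(t):=-\alpha'(t)=\int_0^\infty e^{-st}s\,\mu(ds)$ for $t>0$ and $b(t,s):=\int_0^s c(u)a(t+s-u)\,du$ for $t,s>0$. Stochastic integrals. For a closed interval $I$, $\mathcal{H}_I(X)$ is the set of real-valued measurable functions $f$ on $I$ with $\int_{-\infty}^\infty\{\int_I|f(u)|c(u-s)du\}^2ds<\infty$. A simple function on $I$ is $f=\sum_{k=1}^m a_kI_{(t_{k-1},t_k]}$ with $-\infty<t_0<\dots<t_m<\infty$, $(t_0,t_m]\subset I$, $a_k\in\mathbf{R}$; for it, $\int_I f(s)dX(s):=\sum_{k=1}^m a_k\{X(t_k)-X(t_{k-1})\}$. For $f\in\mathcal{H}_I(X)$, $\int_I f(s)dX(s):=\lim_n\int_I f_n^+(s)dX(s)-\lim_n\int_I f_n^-(s)dX(s)$ in $M(X)$, where $f_n^{\pm}$ are arbitrary nonnegative simple functions on $I$ with $f_n^{\pm}\uparrow f^{\pm}$ a.e. ($f^\pm$ being the positive and negative parts of $f$). *)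

theory Defs
  imports "HOL-Probability.Probability"
begin

subsection \<open>Square-integrable functions\<close>

text \<open>
  Elements of an \<open>L\<^sup>2\<close>-space are represented by functions; every notion below that refers to
  \<open>L\<^sup>2\<close>-elements is a relation that is invariant under changing them on null sets.
\<close>

definition L2_functions :: "'a measure \<Rightarrow> ('a \<Rightarrow> real) set" where
  "L2_functions M = {f. f \<in> borel_measurable M \<and> integrable M (\<lambda>x. (f x)\<^sup>2)}"

definition L2_lim :: "'a measure \<Rightarrow> (nat \<Rightarrow> 'a \<Rightarrow> real) \<Rightarrow> ('a \<Rightarrow> real) \<Rightarrow> bool" where
  "L2_lim M F f \<longleftrightarrow> (\<forall>n. F n \<in> L2_functions M) \<and> f \<in> L2_functions M \<and>
     (\<lambda>n. \<integral>x. (F n x - f x)\<^sup>2 \<partial>M) \<longlonglongrightarrow> 0"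

definition lin_span :: "(real \<Rightarrow> 'w \<Rightarrow> real) \<Rightarrow> real set \<Rightarrow> ('w \<Rightarrow> real) set" where
  "lin_span X I = {\<lambda>\<omega>. \<Sum>t\<in>S. a t * X t \<omega> | S a. finite S \<and> S \<subseteq> I}"

definition closed_span :: "'w measure \<Rightarrow> (real \<Rightarrow> 'w \<Rightarrow> real) \<Rightarrow> real set \<Rightarrow> ('w \<Rightarrow> real) set" where
  "closed_span M X I = {Y. \<exists>F. (\<forall>n. F n \<in> lin_span X I) \<and> L2_lim M F Y}"

text \<open>\<open>Z\<close> is (a version of) the orthogonal projection of \<open>Y \<in> M(X)\<close> onto \<open>M\<^sub>I(X)\<close>.\<close>

definition is_projection ::
  "'w measure \<Rightarrow> (real \<Rightarrow> 'w \<Rightarrow> real) \<Rightarrow> real set \<Rightarrow> ('w \<Rightarrow> real) \<Rightarrow> ('w \<Rightarrow> real) \<Rightarrow> bool" where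
  "is_projection M X I Y Z \<longleftrightarrow> Y \<in> closed_span M X UNIV \<and> Z \<in> closed_span M X I \<and>
     (\<forall>V\<in>closed_span M X I. (\<integral>\<omega>. (Y \<omega> - Z \<omega>) * V \<omega> \<partial>M) = 0)"


subsection \<open>Brownian motion and integrals of deterministic functions\<close>

definition brownian_motion :: "'w measure \<Rightarrow> (real \<Rightarrow> 'w \<Rightarrow> real) \<Rightarrow> bool" where
  "brownian_motion M W \<longleftrightarrow> prob_space M \<and>
     (\<forall>t. W t \<in> borel_measurable M) \<and>
     (AE \<omega> in M. W 0 \<omega> = 0) \<and>
     (AE \<omega> in M. continuous_on UNIV (\<lambda>t. W t \<omega>)) \<and>
     (\<forall>s t. s < t \<longrightarrow>
        distributed M lborel (\<lambda>\<omega>. W t \<omega> - W s \<omega>) (normal_density 0 (sqrt (t - s)))) \<and>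
     (\<forall>n t. (\<forall>k<n. t k < t (Suc k)) \<longrightarrow>
        prob_space.indep_vars M (\<lambda>_. borel) (\<lambda>k \<omega>. W (t (Suc k)) \<omega> - W (t k) \<omega>) {..<n::nat})"

text \<open>\<open>\<phi>\<close> is a simple function on \<open>I\<close> (extended by \<open>0\<close> to the real line), and \<open>Z\<close> is its integral
  with respect to the process \<open>Y\<close>.\<close>

definition has_simple_integral ::
  "(real \<Rightarrow> 'w \<Rightarrow> real) \<Rightarrow> real set \<Rightarrow> (real \<Rightarrow> real) \<Rightarrow> ('w \<Rightarrow> real) \<Rightarrow> bool" where
  "has_simple_integral Y I \<phi> Z \<longleftrightarrow> (\<exists>(m::nat) t a.
     (\<forall>k<m. t k < t (Suc k)) \<and> {t 0<..t m} \<subseteq> I \<and>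
     \<phi> = (\<lambda>x. \<Sum>k<m. a k * indicator {t k<..t (Suc k)} x) \<and>
     Z = (\<lambda>\<omega>. \<Sum>k<m. a k * (Y (t (Suc k)) \<omega> - Y (t k) \<omega>)))"

definition has_wiener_integral ::
  "'w measure \<Rightarrow> (real \<Rightarrow> 'w \<Rightarrow> real) \<Rightarrow> (real \<Rightarrow> real) \<Rightarrow> ('w \<Rightarrow> real) \<Rightarrow> bool" where
  "has_wiener_integral M W f Y \<longleftrightarrow> (\<exists>\<phi> Z.
     (\<forall>n. has_simple_integral W UNIV (\<phi> n) (Z n)) \<and> L2_lim lborel \<phi> f \<and> L2_lim M Z Y)"

definition simple_approx ::
  "(real \<Rightarrow> 'w \<Rightarrow> real) \<Rightarrow> real set \<Rightarrow> (real \<Rightarrow> real) \<Rightarrow> (nat \<Rightarrow> real \<Rightarrow> real) \<Rightarrow> (nat \<Rightarrow> 'w \<Rightarrow> real) \<Rightarrow> bool"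
where
  "simple_approx X I f \<phi> Z \<longleftrightarrow>
     (\<forall>n. has_simple_integral X I (\<phi> n) (Z n)) \<and> (\<forall>n x. 0 \<le> \<phi> n x) \<and>
     (AE x in lborel. x \<in> I \<longrightarrow> incseq (\<lambda>n. \<phi> n x) \<and> (\<lambda>n. \<phi> n x) \<longlonglongrightarrow> f x)"

text \<open>
  The limit has to exist and to be the same for every approximating sequence of simple functions;
  the first conjunct keeps this from being vacuous.
\<close>

definition has_nonneg_integral ::
  "'w measure \<Rightarrow> (real \<Rightarrow> 'w \<Rightarrow> real) \<Rightarrow> real set \<Rightarrow> (real \<Rightarrow> real) \<Rightarrow> ('w \<Rightarrow> real) \<Rightarrow> bool" where
  "has_nonneg_integral M X I f J \<longleftrightarrow>
     (\<exists>\<phi> Z. simple_approx X I f \<phi> Z) \<and> (\<forall>\<phi> Z. simple_approx X I f \<phi> Z \<longrightarrow> L2_lim M Z J)"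

definition has_stochastic_integral ::
  "'w measure \<Rightarrow> (real \<Rightarrow> 'w \<Rightarrow> real) \<Rightarrow> real set \<Rightarrow> (real \<Rightarrow> real) \<Rightarrow> ('w \<Rightarrow> real) \<Rightarrow> bool" where
  "has_stochastic_integral M X I f J \<longleftrightarrow> (\<exists>Jp Jn.
     has_nonneg_integral M X I (\<lambda>x. max (f x) 0) Jp \<and>
     has_nonneg_integral M X I (\<lambda>x. max (- f x) 0) Jn \<and>
     J = (\<lambda>\<omega>. Jp \<omega> - Jn \<omega>))"

text \<open>Only the values of \<open>f\<close> on \<open>I\<close> matter.\<close>

definition H_space :: "(real \<Rightarrow> real) \<Rightarrow> real set \<Rightarrow> (real \<Rightarrow> real) set" where
  "H_space c I = {f. set_borel_measurable borel I f \<and>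
     (\<integral>\<^sup>+s. (\<integral>\<^sup>+u\<in>I. ennreal (\<bar>f u\<bar> * c (u - s)) \<partial>lborel)\<^sup>2 \<partial>lborel) < \<infinity>}"


subsection \<open>Coefficients and the kernel\<close>

definition borel_measure_on_pos :: "real measure \<Rightarrow> bool" where
  "borel_measure_on_pos \<nu> \<longleftrightarrow> sets \<nu> = sets (restrict_space borel {0<..})"

definition MA_coeff :: "real measure \<Rightarrow> real \<Rightarrow> real" where
  "MA_coeff \<nu> t = (if t > 0 then \<integral>s. exp (- t * s) \<partial>\<nu> else 0)"

definition MA_primitive :: "real measure \<Rightarrow> real \<Rightarrow> real" where
  "MA_primitive \<nu> t = (LBINT s=0..t. MA_coeff \<nu> s)"

text \<open>\<open>AR_alpha\<close> and \<open>AR_coeff\<close> are meaningful for positive arguments only, and \<open>kernel_b\<close> for a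
  pair of positive arguments.\<close>

definition AR_alpha :: "real measure \<Rightarrow> real \<Rightarrow> real" where
  "AR_alpha \<mu> t = (\<integral>s. exp (- s * t) \<partial>\<mu>)"

definition AR_coeff :: "real measure \<Rightarrow> real \<Rightarrow> real" where
  "AR_coeff \<mu> t = - deriv (AR_alpha \<mu>) t"

definition kernel_b :: "real measure \<Rightarrow> real measure \<Rightarrow> real \<Rightarrow> real \<Rightarrow> real" where
  "kernel_b \<nu> \<mu> t s = (LBINT u:{0<..<s}. MA_coeff \<nu> u * AR_coeff \<mu> (t + s - u))"

definition AR_measure :: "real measure \<Rightarrow> real measure \<Rightarrow> bool" where
  "AR_measure \<nu> \<mu> \<longleftrightarrow> borel_measure_on_pos \<mu> \<and>
     (\<integral>\<^sup>+s. ennreal (1 / (1 + s)) \<partial>\<mu>) < \<infinity> \<and>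
     emeasure \<mu> {0<..} = \<infinity> \<and>
     (\<integral>\<^sup>+s. ennreal (1 / s) \<partial>\<mu>) = \<infinity> \<and>
     (\<forall>z. Im z > 0 \<longrightarrow>
        - \<i> * z * (LBINT t:{0<..}. exp (\<i> * z * of_real t) * complex_of_real (MA_coeff \<nu> t))
               * (LBINT t:{0<..}. exp (\<i> * z * of_real t) * complex_of_real (AR_alpha \<mu> t)) = 1)"

end

theory Submission
  imports Defs
begin

text \<open>
  Write \<open>c\<close>, \<open>g\<close> and \<open>\<alpha>\<close> for the coefficient, its primitive and the Laplace transform of \<open>\<mu>\<close>, put
  \<open>L = T - t\<^sub>1\<close>, and call \<open>k\<close> the kernel of a random variable \<open>Y\<close> if \<open>Y\<close> is the Wiener integral of
  \<open>k\<close>. Passing from a random variable to its kernel preserves inner products, so orthogonality can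
  be tested on kernels. The kernel of \<open>X t\<close> is \<open>g (t - s) - g (- s)\<close>, which vanishes for
  \<open>s \<ge> max t 0\<close>. The integral of \<open>\<phi>\<close> with respect to \<open>X\<close> has the kernel
  \<open>\<integral> \<phi> u c (u - s) du\<close>, because this is so for indicators of intervals and passes to increasing
  limits.

  Hence \<open>X T - X t\<^sub>1 - \<integral> f dX\<close> is orthogonal to \<open>X t\<close> for all \<open>t \<le> t\<^sub>1\<close> as soon as its kernel vanishes
  on \<open>s < t\<^sub>1\<close>. With \<open>f s = h (t\<^sub>1 - s)\<close>, where \<open>h r\<close> is the integral of \<open>b r \<tau>\<close> over \<open>0 < \<tau> < L\<close>, and
  with \<open>x = t\<^sub>1 - s\<close>, this says that

    \<open>(h * c) x = g (x + L) - g x\<close>  for almost every \<open>x > 0\<close>    (lemma \<open>conv_integrated_b_c\<close>).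

  The relation between the Fourier transforms of \<open>c\<close> and \<open>\<alpha>\<close> means that \<open>c * \<alpha> = 1\<close> almost
  everywhere on the positive half-line (lemma \<open>laplace_convolution_eq_1\<close>). Since \<open>- \<alpha>'\<close> is the AR
  coefficient, integrating \<open>b\<close> over \<open>\<tau>\<close> and then splitting the convolution \<open>c * \<alpha>\<close> at \<open>L + r\<close> according
  to whether the argument of \<open>c\<close> is below or above \<open>L\<close> gives \<open>h + 1 = g L \<alpha> + c (L + \<cdot>) * \<alpha>\<close>.
  Convolving with \<open>c\<close> and using \<open>c * \<alpha> = 1\<close> twice more turns this into
  \<open>h * c + g = g L + (c (L + \<cdot>) * 1) = g (\<cdot> + L)\<close>. Every function here is nonnegative, so the whole
  computation takes place among extended nonnegative integrals, without integrability questions.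

  The same identity shows that \<open>f\<close> lies in \<open>\<H>\<close>: the difference \<open>g (x + L) - g x\<close> is bounded near \<open>0\<close>
  and at most \<open>L c x\<close> further out. The integral of \<open>f\<close> exists because \<open>f\<close> is increasing, hence an
  increasing almost everywhere limit of step functions (lemma \<open>step_approx_exists\<close>), and because
  \<open>L\<^sup>2\<close> of a probability space is complete.
\<close>

section \<open>Square-integrable functions\<close>

lemma L2_functionsD:
  assumes "f \<in> L2_functions M"
  shows "f \<in> borel_measurable M" "integrable M (\<lambda>x. (f x)\<^sup>2)"
  using assms by (auto simp: L2_functions_def)

lemma L2_mult_integrable:
  assumes "f \<in> L2_functions M" "g \<in> L2_functions M"
  shows "integrable M (\<lambda>x. f x * g x)"
proof (rule Bochner_Integration.integrable_bound)
  note [measurable] = L2_functionsD(1)[OF assms(1)] L2_functionsD(1)[OF assms(2)]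
  show "integrable M (\<lambda>x. (f x)\<^sup>2 + (g x)\<^sup>2)"
    using assms[THEN L2_functionsD(2)] by auto
  show "(\<lambda>x. f x * g x) \<in> borel_measurable M" by measurable
  have "\<bar>a * b\<bar> \<le> a\<^sup>2 + b\<^sup>2" for a b :: real
    using sum_squares_bound[of a b] sum_squares_bound[of a "-b"] zero_le_power2[of a] zero_le_power2[of b]
    by (auto simp: abs_if)
  then show "AE x in M. norm (f x * g x) \<le> norm ((f x)\<^sup>2 + (g x)\<^sup>2)"
    by (auto intro!: AE_I2)
qed

lemma L2_zero: "(\<lambda>_. 0) \<in> L2_functions M"
  by (auto simp: L2_functions_def)

lemma L2_add_scaled:
  assumes "f \<in> L2_functions M" "g \<in> L2_functions M"
  shows "(\<lambda>x. f x + a * g x) \<in> L2_functions M"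
proof -
  note [measurable] = L2_functionsD(1)[OF assms(1)] L2_functionsD(1)[OF assms(2)]
  have "integrable M (\<lambda>x. (f x)\<^sup>2 + 2 * a * (f x * g x) + a\<^sup>2 * (g x)\<^sup>2)"
    using assms[THEN L2_functionsD(2)] L2_mult_integrable[OF assms] by auto
  also have "(\<lambda>x. (f x)\<^sup>2 + 2 * a * (f x * g x) + a\<^sup>2 * (g x)\<^sup>2) = (\<lambda>x. (f x + a * g x)\<^sup>2)"
    by (auto simp: power2_eq_square algebra_simps)
  finally show ?thesis by (auto simp: L2_functions_def)
qed

lemma L2_diff:
  assumes "f \<in> L2_functions M" "g \<in> L2_functions M"
  shows "(\<lambda>x. f x - g x) \<in> L2_functions M"
  using L2_add_scaled[OF assms, of "-1"] by simp

lemma L2_Cauchy_Schwarz: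
  assumes "f \<in> L2_functions M" "g \<in> L2_functions M"
  shows "\<bar>\<integral>x. f x * g x \<partial>M\<bar> \<le> sqrt (\<integral>x. (f x)\<^sup>2 \<partial>M) * sqrt (\<integral>x. (g x)\<^sup>2 \<partial>M)"
proof -
  note [measurable] = L2_functionsD(1)[OF assms(1)] L2_functionsD(1)[OF assms(2)]
  note sq = assms[THEN L2_functionsD(2)]
  have i: "integrable M (\<lambda>x. \<bar>f x\<bar> * \<bar>g x\<bar>)"
    using integrable_abs[OF L2_mult_integrable[OF assms]] by (simp add: abs_mult)
  have "ennreal ((\<integral>x. \<bar>f x\<bar> * \<bar>g x\<bar> \<partial>M)\<^sup>2) = (\<integral>\<^sup>+x. ennreal \<bar>f x\<bar> * ennreal \<bar>g x\<bar> \<partial>M)\<^sup>2"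
    using i by (simp add: nn_integral_eq_integral ennreal_power integral_nonneg_AE flip: ennreal_mult)
  also have "\<dots> \<le> (\<integral>\<^sup>+x. (ennreal \<bar>f x\<bar>)\<^sup>2 \<partial>M) * (\<integral>\<^sup>+x. (ennreal \<bar>g x\<bar>)\<^sup>2 \<partial>M)"
    by (intro Cauchy_Schwarz_nn_integral) auto
  also have "\<dots> = ennreal ((\<integral>x. (f x)\<^sup>2 \<partial>M) * (\<integral>x. (g x)\<^sup>2 \<partial>M))"
    using sq by (simp add: nn_integral_eq_integral ennreal_power integral_nonneg_AE ennreal_mult)
  finally have "(\<integral>x. \<bar>f x\<bar> * \<bar>g x\<bar> \<partial>M)\<^sup>2 \<le> (\<integral>x. (f x)\<^sup>2 \<partial>M) * (\<integral>x. (g x)\<^sup>2 \<partial>M)"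
    by (subst (asm) ennreal_le_iff) (auto intro!: mult_nonneg_nonneg integral_nonneg_AE)
  then have "(\<integral>x. \<bar>f x\<bar> * \<bar>g x\<bar> \<partial>M) \<le> sqrt (\<integral>x. (f x)\<^sup>2 \<partial>M) * sqrt (\<integral>x. (g x)\<^sup>2 \<partial>M)"
    using real_le_rsqrt by (simp flip: real_sqrt_mult)
  moreover have "\<bar>\<integral>x. f x * g x \<partial>M\<bar> \<le> (\<integral>x. \<bar>f x\<bar> * \<bar>g x\<bar> \<partial>M)"
    using integral_abs_bound[of M "\<lambda>x. f x * g x"] by (simp add: abs_mult)
  ultimately show ?thesis by linarith
qed

lemma L2_limD:
  assumes "L2_lim M F f"
  shows "F n \<in> L2_functions M" "f \<in> L2_functions M" "(\<lambda>n. \<integral>x. (F n x - f x)\<^sup>2 \<partial>M) \<longlonglongrightarrow> 0"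
  using assms by (auto simp: L2_lim_def)

lemma L2_lim_inner:
  assumes "L2_lim M F f" and g: "g \<in> L2_functions M"
  shows "(\<lambda>n. \<integral>x. F n x * g x \<partial>M) \<longlonglongrightarrow> (\<integral>x. f x * g x \<partial>M)"
proof (rule LIM_zero_cancel, rule tendsto_rabs_zero_cancel, rule tendsto_sandwich[OF _ _ tendsto_const])
  note F = L2_limD(1)[OF assms(1)] and f = L2_limD(2)[OF assms(1)]
  have d: "(\<lambda>x. F n x - f x) \<in> L2_functions M" for n
    by (intro L2_diff F f)
  have "(\<integral>x. F n x * g x \<partial>M) - (\<integral>x. f x * g x \<partial>M) = (\<integral>x. (F n x - f x) * g x \<partial>M)" for n
    by (simp add: left_diff_distrib Bochner_Integration.integral_diff[OF L2_mult_integrable[OF F g] L2_mult_integrable[OF f g]])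
  then show "\<forall>\<^sub>F n in sequentially. \<bar>(\<integral>x. F n x * g x \<partial>M) - (\<integral>x. f x * g x \<partial>M)\<bar>
     \<le> sqrt (\<integral>x. (F n x - f x)\<^sup>2 \<partial>M) * sqrt (\<integral>x. (g x)\<^sup>2 \<partial>M)"
    using L2_Cauchy_Schwarz[OF d g] by (auto intro!: always_eventually)
  have "(\<lambda>n. sqrt (\<integral>x. (F n x - f x)\<^sup>2 \<partial>M) * sqrt (\<integral>x. (g x)\<^sup>2 \<partial>M)) \<longlonglongrightarrow> sqrt 0 * sqrt (\<integral>x. (g x)\<^sup>2 \<partial>M)"
    by (intro tendsto_intros L2_limD(3)[OF assms(1)])
  then show "(\<lambda>n. sqrt (\<integral>x. (F n x - f x)\<^sup>2 \<partial>M) * sqrt (\<integral>x. (g x)\<^sup>2 \<partial>M)) \<longlonglongrightarrow> 0" by simp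
qed auto

lemma L2_lim_add_scaled:
  assumes "L2_lim M F f" "L2_lim M G g"
  shows "L2_lim M (\<lambda>n x. F n x + a * G n x) (\<lambda>x. f x + a * g x)"
  unfolding L2_lim_def
proof (intro conjI allI)
  note L = L2_limD[OF assms(1)] L2_limD[OF assms(2)]
  show 1: "(\<lambda>x. F n x + a * G n x) \<in> L2_functions M" for n by (intro L2_add_scaled L)
  show 2: "(\<lambda>x. f x + a * g x) \<in> L2_functions M" by (intro L2_add_scaled L)
  have dF: "integrable M (\<lambda>x. (F n x - f x)\<^sup>2)" "integrable M (\<lambda>x. (G n x - g x)\<^sup>2)" for n
    by (intro L2_functionsD(2) L2_diff L)+
  show "(\<lambda>n. \<integral>x. (F n x + a * G n x - (f x + a * g x))\<^sup>2 \<partial>M) \<longlonglongrightarrow> 0"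
  proof (rule tendsto_sandwich[OF _ _ tendsto_const])
    have "(F n x + a * G n x - (f x + a * g x))\<^sup>2 \<le> 2 * (F n x - f x)\<^sup>2 + 2 * a\<^sup>2 * (G n x - g x)\<^sup>2" for n x
      using zero_le_power2[of "(F n x - f x) - a * (G n x - g x)"]
      by (simp add: power2_eq_square algebra_simps)
    then have "(\<integral>x. (F n x + a * G n x - (f x + a * g x))\<^sup>2 \<partial>M) \<le> (\<integral>x. 2 * (F n x - f x)\<^sup>2 + 2 * a\<^sup>2 * (G n x - g x)\<^sup>2 \<partial>M)" for n
      using dF by (intro integral_mono L2_functionsD(2) L2_diff 1 2) auto
    then show "\<forall>\<^sub>F n in sequentially. (\<integral>x. (F n x + a * G n x - (f x + a * g x))\<^sup>2 \<partial>M)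
      \<le> 2 * (\<integral>x. (F n x - f x)\<^sup>2 \<partial>M) + 2 * a\<^sup>2 * (\<integral>x. (G n x - g x)\<^sup>2 \<partial>M)"
      using dF by (intro always_eventually) auto
    have "(\<lambda>n. 2 * (\<integral>x. (F n x - f x)\<^sup>2 \<partial>M) + 2 * a\<^sup>2 * (\<integral>x. (G n x - g x)\<^sup>2 \<partial>M)) \<longlonglongrightarrow> 2 * 0 + 2 * a\<^sup>2 * 0"
      by (intro tendsto_intros L)
    then show "(\<lambda>n. 2 * (\<integral>x. (F n x - f x)\<^sup>2 \<partial>M) + 2 * a\<^sup>2 * (\<integral>x. (G n x - g x)\<^sup>2 \<partial>M)) \<longlonglongrightarrow> 0"
      by simp
  qed auto
qed

lemma L2_lim_const: "f \<in> L2_functions M \<Longrightarrow> L2_lim M (\<lambda>_. f) f"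
  by (simp add: L2_lim_def)

text \<open>
  Riesz--Fischer. Along a subsequence the increments have norms at most \<open>2\<^sup>-\<^sup>k\<close>, so they are
  absolutely summable almost everywhere and the subsequence has a pointwise limit; Fatou's lemma
  turns this into convergence in mean square. Finiteness of the measure bounds the integral of an
  increment by its norm.
\<close>

lemma L2_complete:
  assumes M: "prob_space M" and F: "\<And>n. F n \<in> L2_functions M"
    and Cauchy: "\<And>e. e > 0 \<Longrightarrow> \<exists>N. \<forall>m\<ge>N. \<forall>n\<ge>N. (\<integral>x. (F m x - F n x)\<^sup>2 \<partial>M) \<le> e"
  shows "\<exists>f. L2_lim M F f"
proof -
  interpret prob_space M by fact
  note [measurable] = L2_functionsD(1)[OF F]
  have "\<exists>N. \<forall>m\<ge>N. \<forall>n\<ge>N. (\<integral>x. (F m x - F n x)\<^sup>2 \<partial>M) \<le> (1/4) ^ k" for k :: nat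
    by (intro Cauchy) auto
  then obtain N where N: "\<And>k m n. m \<ge> N k \<Longrightarrow> n \<ge> N k \<Longrightarrow> (\<integral>x. (F m x - F n x)\<^sup>2 \<partial>M) \<le> (1/4) ^ k"
    by metis
  \<comment> \<open>Summing makes the indices monotone; adding \<open>k\<close> makes them unbounded.\<close>
  define r where "r k = (\<Sum>i\<le>k. N i) + k" for k
  have rN: "r k \<ge> N k" for k
    unfolding r_def by (rule trans_le_add1) (auto intro!: member_le_sum)
  have rk: "r k \<ge> k" for k by (simp add: r_def)
  have rmono: "r k \<le> r (Suc k)" for k by (simp add: r_def)
  define D where "D k x = F (r (Suc k)) x - F (r k) x" for k x
  have D2: "D k \<in> L2_functions M" for k
    unfolding D_def by (intro L2_diff F)
  note [measurable] = L2_functionsD(1)[OF D2]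
  have Dsq: "(\<integral>x. (D k x)\<^sup>2 \<partial>M) \<le> (1/4)^k" for k
    unfolding D_def using rN[of k] rmono[of k] by (intro N) auto
  have D1: "integrable M (D k)" for k
    using L2_mult_integrable[OF D2[of k], of "\<lambda>_. 1"] by (simp add: L2_functions_def)
  have Dabs: "(\<integral>x. norm (D k x) \<partial>M) \<le> (1/2)^k" for k
  proof -
    \<comment> \<open>The weights balance \<open>d\<^sup>2\<close> of size \<open>4\<^sup>-\<^sup>k\<close> against the constant, so that both halves integrate to \<open>2\<^sup>-\<^sup>k\<close>.\<close>
    have "\<bar>d\<bar> \<le> (2^k * d\<^sup>2 + (1/2)^k) / 2" for d :: real
    proof -
      have "0 \<le> 2^k * (\<bar>d\<bar> - (1/2)^k)\<^sup>2" by simp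
      also have "\<dots> = 2^k * d\<^sup>2 + (1/2)^k - 2 * \<bar>d\<bar>"
        by (simp add: power2_eq_square algebra_simps power_one_over)
      finally show ?thesis by simp
    qed
    then have "(\<integral>x. norm (D k x) \<partial>M) \<le> (\<integral>x. (2^k * (D k x)\<^sup>2 + (1/2)^k) / 2 \<partial>M)"
      using D1 D2[THEN L2_functionsD(2)] by (intro integral_mono) auto
    also have "\<dots> = (2^k * (\<integral>x. (D k x)\<^sup>2 \<partial>M) + (1/2)^k) / 2"
      using D2[THEN L2_functionsD(2)] by (simp add: prob_space)
    also have "\<dots> \<le> (2^k * (1/4)^k + (1/2)^k) / 2"
      using Dsq[of k] by (intro divide_right_mono add_mono mult_left_mono) auto
    also have "\<dots> = (1/2)^k"
      by (simp flip: power_mult_distrib)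
    finally show ?thesis .
  qed
  have "(\<integral>\<^sup>+x. (\<Sum>k. ennreal (norm (D k x))) \<partial>M) = (\<Sum>k. \<integral>\<^sup>+x. ennreal (norm (D k x)) \<partial>M)"
    by (intro nn_integral_suminf) auto
  also have "\<dots> \<le> (\<Sum>k. ennreal ((1/2)^k))"
    using Dabs D1 by (intro suminf_le) (auto simp: nn_integral_eq_integral)
  also have "\<dots> = ennreal (\<Sum>k. (1/2)^k)"
    by (intro suminf_ennreal2) auto
  also have "\<dots> < \<infinity>" by simp
  finally have "AE x in M. (\<Sum>k. ennreal (norm (D k x))) \<noteq> \<infinity>"
    by (intro nn_integral_PInf_AE) auto
  then have conv: "AE x in M. convergent (\<lambda>k. F (r k) x)"
  proof eventually_elim
    fix x assume "(\<Sum>k. ennreal (norm (D k x))) \<noteq> \<infinity>"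
    then have "summable (\<lambda>k. norm (D k x))"
      by (intro summable_suminf_not_top) auto
    then have "summable (\<lambda>k. D k x)" by (rule summable_norm_cancel)
    then have "convergent (\<lambda>n. \<Sum>k<n. D k x)" by (simp add: summable_iff_convergent)
    moreover have "(\<Sum>k<n. D k x) = F (r n) x - F (r 0) x" for n
      unfolding D_def by (rule sum_lessThan_telescope)
    ultimately have "convergent (\<lambda>n. F (r n) x - F (r 0) x)" by simp
    from convergent_add[OF this convergent_const[of "F (r 0) x"]] show "convergent (\<lambda>k. F (r k) x)"
      by simp
  qed
  define f where "f x = lim (\<lambda>k. F (r k) x)" for x
  have [measurable]: "f \<in> borel_measurable M"
    unfolding f_def by measurable
  have flim: "AE x in M. (\<lambda>k. F (r k) x) \<longlonglongrightarrow> f x"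
    using conv unfolding f_def by eventually_elim (simp add: convergent_LIMSEQ_iff)
  have Fatou: "(\<integral>\<^sup>+x. ennreal ((F n x - f x)\<^sup>2) \<partial>M) \<le> ennreal ((1/4)^j)" if "n \<ge> N j" for n j
  proof -
    have "(\<integral>\<^sup>+x. ennreal ((F n x - f x)\<^sup>2) \<partial>M) = (\<integral>\<^sup>+x. liminf (\<lambda>k. ennreal ((F n x - F (r k) x)\<^sup>2)) \<partial>M)"
    proof (rule nn_integral_cong_AE, use flim in eventually_elim)
      case (elim x)
      have "(\<lambda>k. ennreal ((F n x - F (r k) x)\<^sup>2)) \<longlonglongrightarrow> ennreal ((F n x - f x)\<^sup>2)"
        by (intro tendsto_intros elim)
      then show ?case by (intro lim_imp_Liminf[symmetric]) auto
    qed
    also have "\<dots> \<le> liminf (\<lambda>k. \<integral>\<^sup>+x. ennreal ((F n x - F (r k) x)\<^sup>2) \<partial>M)"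
      by (intro nn_integral_liminf) auto
    also have "\<dots> \<le> limsup (\<lambda>k. \<integral>\<^sup>+x. ennreal ((F n x - F (r k) x)\<^sup>2) \<partial>M)"
      by (intro Liminf_le_Limsup) auto
    also have "\<dots> \<le> ennreal ((1/4)^j)"
    proof (rule Limsup_bounded)
      show "\<forall>\<^sub>F k in sequentially. (\<integral>\<^sup>+x. ennreal ((F n x - F (r k) x)\<^sup>2) \<partial>M) \<le> ennreal ((1/4)^j)"
        using eventually_ge_at_top[of "N j"]
      proof eventually_elim
        case (elim k)
        then have "(\<integral>x. (F n x - F (r k) x)\<^sup>2 \<partial>M) \<le> (1/4)^j"
          using rk[of k] that by (intro N) auto
        then show ?case
          using L2_functionsD(2)[OF L2_diff[OF F[of n] F[of "r k"]]]
          by (simp add: nn_integral_eq_integral)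
      qed
    qed
    finally show ?thesis .
  qed
  have dL2: "(\<lambda>x. F (N 0) x - f x) \<in> L2_functions M"
    unfolding L2_functions_def using Fatou[of 0 "N 0"]
    by (auto intro!: integrableI_bounded simp: le_less_trans)
  have fL2: "f \<in> L2_functions M"
    using L2_diff[OF F[of "N 0"] dL2] by simp
  have "(\<lambda>n. \<integral>x. (F n x - f x)\<^sup>2 \<partial>M) \<longlonglongrightarrow> 0"
  proof (rule LIMSEQ_I)
    fix e :: real assume "e > 0"
    then obtain j where j: "(1/4::real)^j < e"
      using real_arch_pow_inv[of e "1/4"] by auto
    have "norm ((\<integral>x. (F n x - f x)\<^sup>2 \<partial>M) - 0) < e" if "n \<ge> N j" for n
    proof -
      have "ennreal (\<integral>x. (F n x - f x)\<^sup>2 \<partial>M) \<le> ennreal ((1/4)^j)"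
        using Fatou[OF that] L2_functionsD(2)[OF L2_diff[OF F[of n] fL2]]
        by (simp add: nn_integral_eq_integral)
      then have "(\<integral>x. (F n x - f x)\<^sup>2 \<partial>M) \<le> (1/4)^j"
        by (subst (asm) ennreal_le_iff) auto
      with j show ?thesis by (simp add: integral_nonneg_AE)
    qed
    then show "\<exists>no. \<forall>n\<ge>no. norm ((\<integral>x. (F n x - f x)\<^sup>2 \<partial>M) - 0) < e" by blast
  qed
  with F fL2 show ?thesis unfolding L2_lim_def by blast
qed

section \<open>Isometries generated by pairs with equal inner products\<close>

text \<open>
  The graph of the isometry between closed subspaces of two \<open>L\<^sup>2\<close>-spaces that extends a relation \<open>B\<close>
  between generators. Being closed under linear combinations and simultaneous limits, this one
  relation covers the integral with respect to Brownian motion, the process \<open>X\<close> and the integrals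
  with respect to \<open>X\<close>.
\<close>

inductive isometric_closure ::
  "'a measure \<Rightarrow> 'b measure \<Rightarrow> (('a \<Rightarrow> real) \<Rightarrow> ('b \<Rightarrow> real) \<Rightarrow> bool) \<Rightarrow> ('a \<Rightarrow> real) \<Rightarrow> ('b \<Rightarrow> real) \<Rightarrow> bool"
  for M N B where
  base: "B Y y \<Longrightarrow> isometric_closure M N B Y y"
| zero: "isometric_closure M N B (\<lambda>_. 0) (\<lambda>_. 0)"
| add_scaled: "isometric_closure M N B Y y \<Longrightarrow> isometric_closure M N B Z z \<Longrightarrow>
    isometric_closure M N B (\<lambda>x. Y x + a * Z x) (\<lambda>x. y x + a * z x)"
| lim: "(\<And>n. isometric_closure M N B (F n) (f n)) \<Longrightarrow> L2_lim M F Y \<Longrightarrow> L2_lim N f y \<Longrightarrow>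
    isometric_closure M N B Y y"

lemma isometric_closure_diff:
  assumes "isometric_closure M N B Y y" "isometric_closure M N B Z z"
  shows "isometric_closure M N B (\<lambda>x. Y x - Z x) (\<lambda>x. y x - z x)"
  using isometric_closure.add_scaled[OF assms, of "-1"] by simp

lemma isometric_closure_sum:
  assumes "\<And>i. i \<in> S \<Longrightarrow> isometric_closure M N B (Y i) (y i)"
  shows "isometric_closure M N B (\<lambda>x. \<Sum>i\<in>S. a i * Y i x) (\<lambda>x. \<Sum>i\<in>S. a i * y i x)"
  using assms
proof (induction S rule: infinite_finite_induct)
  case (insert i S)
  then have "isometric_closure M N B (\<lambda>x. (\<Sum>i\<in>S. a i * Y i x) + a i * Y i x) (\<lambda>x. (\<Sum>i\<in>S. a i * y i x) + a i * y i x)"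
    by (intro isometric_closure.add_scaled) auto
  with insert show ?case by (simp add: add.commute)
qed (simp_all add: isometric_closure.zero)

locale inner_product_preserving =
  fixes M :: "'a measure" and N :: "'b measure" and B
  assumes B_L2: "\<And>Y y. B Y y \<Longrightarrow> Y \<in> L2_functions M \<and> y \<in> L2_functions N"
    and B_inner: "\<And>Y y Z z. B Y y \<Longrightarrow> B Z z \<Longrightarrow> (\<integral>x. Y x * Z x \<partial>M) = (\<integral>x. y x * z x \<partial>N)"
begin

lemma isometric_closure_L2:
  "isometric_closure M N B Y y \<Longrightarrow> Y \<in> L2_functions M \<and> y \<in> L2_functions N"
proof (induction rule: isometric_closure.induct)
  case (add_scaled Y y Z z a)
  then show ?case by (auto intro: L2_add_scaled)
next
  case (lim F f Y y)
  then show ?case by (auto simp: L2_lim_def)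
qed (simp_all add: B_L2 L2_zero)

text \<open>
  One half of the double induction for \<open>isometric_closure_inner\<close>: the second factor is held fixed.
\<close>

lemma isometric_closure_inner_step:
  assumes "isometric_closure M N B Y y" and Z: "Z \<in> L2_functions M" "z \<in> L2_functions N"
    and B: "\<And>Y y. B Y y \<Longrightarrow> (\<integral>x. Y x * Z x \<partial>M) = (\<integral>x. y x * z x \<partial>N)"
  shows "(\<integral>x. Y x * Z x \<partial>M) = (\<integral>x. y x * z x \<partial>N)"
  using assms(1)
proof (induction rule: isometric_closure.induct)
  case (add_scaled Y y Y' y' a)
  note L = isometric_closure_L2[OF add_scaled.hyps(1)] isometric_closure_L2[OF add_scaled.hyps(2)]
  note I = L2_mult_integrable[OF _ Z(1)] L2_mult_integrable[OF _ Z(2)]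
  show ?case using add_scaled.IH L by (simp add: distrib_right mult.assoc I)
next
  case (lim F f Y y)
  have "(\<lambda>n. \<integral>x. F n x * Z x \<partial>M) \<longlonglongrightarrow> (\<integral>x. Y x * Z x \<partial>M)"
    by (rule L2_lim_inner[OF lim.hyps(2) Z(1)])
  moreover have "(\<lambda>n. \<integral>x. F n x * Z x \<partial>M) \<longlonglongrightarrow> (\<integral>x. y x * z x \<partial>N)"
    unfolding lim.IH by (rule L2_lim_inner[OF lim.hyps(3) Z(2)])
  ultimately show ?case by (rule LIMSEQ_unique)
qed (auto simp: B)

lemma isometric_closure_inner:
  assumes Y: "isometric_closure M N B Y y" and Z: "isometric_closure M N B Z z"
  shows "(\<integral>x. Y x * Z x \<partial>M) = (\<integral>x. y x * z x \<partial>N)"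
proof (rule isometric_closure_inner_step[OF Y])
  fix U u assume U: "B U u"
  have "(\<integral>x. Z x * U x \<partial>M) = (\<integral>x. z x * u x \<partial>N)"
    by (rule isometric_closure_inner_step[OF Z]) (auto simp: B_L2[OF U] intro: B_inner U)
  then show "(\<integral>x. U x * Z x \<partial>M) = (\<integral>x. u x * z x \<partial>N)" by (simp add: mult.commute)
qed (use isometric_closure_L2[OF Z] in auto)

text \<open>
  The isometry carries the Cauchy property of the kernels over to the random variables, and
  completeness does the rest.
\<close>

lemma isometric_closure_lim_exists:
  assumes M: "prob_space M" and F: "\<And>n. isometric_closure M N B (F n) (f n)" and f: "L2_lim N f y"
  shows "\<exists>Y. L2_lim M F Y"
proof (rule L2_complete[OF M])
  show "F n \<in> L2_functions M" for n using isometric_closure_L2[OF F] by auto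
  fix e :: real assume "e > 0"
  then have "\<forall>\<^sub>F n in sequentially. (\<integral>x. (f n x - y x)\<^sup>2 \<partial>N) < e / 4"
    by (intro order_tendstoD(2)[OF L2_limD(3)[OF f]]) auto
  then obtain K where K: "\<And>n. n \<ge> K \<Longrightarrow> (\<integral>x. (f n x - y x)\<^sup>2 \<partial>N) < e / 4"
    by (auto simp: eventually_sequentially)
  note d = L2_functionsD(2)[OF L2_diff[OF L2_limD(1)[OF f] L2_limD(2)[OF f]]]
  have "(\<integral>x. (F m x - F n x)\<^sup>2 \<partial>M) \<le> e" if mn: "m \<ge> K" "n \<ge> K" for m n
  proof -
    have "(\<integral>x. (F m x - F n x)\<^sup>2 \<partial>M) = (\<integral>x. (f m x - f n x)\<^sup>2 \<partial>N)"
      using isometric_closure_inner[OF isometric_closure_diff isometric_closure_diff, OF F F F F, of m n m n]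
      by (simp add: power2_eq_square)
    also have "\<dots> \<le> (\<integral>x. 2 * (f m x - y x)\<^sup>2 + 2 * (f n x - y x)\<^sup>2 \<partial>N)"
    proof (rule integral_mono)
      show "integrable N (\<lambda>x. (f m x - f n x)\<^sup>2)"
        by (intro L2_functionsD(2) L2_diff L2_limD(1)[OF f])
      show "(f m x - f n x)\<^sup>2 \<le> 2 * (f m x - y x)\<^sup>2 + 2 * (f n x - y x)\<^sup>2" for x
        using zero_le_power2[of "(f m x - y x) + (f n x - y x)"]
        by (simp add: power2_eq_square algebra_simps)
    qed (use d in auto)
    also have "\<dots> \<le> e" using K[OF mn(1)] K[OF mn(2)] d by simp
    finally show ?thesis .
  qed
  then show "\<exists>K. \<forall>m\<ge>K. \<forall>n\<ge>K. (\<integral>x. (F m x - F n x)\<^sup>2 \<partial>M) \<le> e" by blast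
qed

text \<open>
  The limit depends on the limiting kernel only. This is what makes an integral independent of the
  approximating sequence.
\<close>

lemma isometric_closure_lim_unique:
  assumes F: "\<And>n. isometric_closure M N B (F n) (f n)" and f: "L2_lim N f y" and Y: "isometric_closure M N B Y y"
  shows "L2_lim M F Y"
proof -
  have "(\<integral>x. (F n x - Y x)\<^sup>2 \<partial>M) = (\<integral>x. (f n x - y x)\<^sup>2 \<partial>N)" for n
    using isometric_closure_inner[OF isometric_closure_diff isometric_closure_diff, OF F Y F Y, of n n]
    by (simp add: power2_eq_square)
  then show ?thesis
    using L2_limD(3)[OF f] isometric_closure_L2[OF F] isometric_closure_L2[OF Y] by (simp add: L2_lim_def)
qed

end

section \<open>Integrals with respect to Brownian motion\<close>

definition wiener_pair :: "(real \<Rightarrow> 'w \<Rightarrow> real) \<Rightarrow> ('w \<Rightarrow> real) \<Rightarrow> (real \<Rightarrow> real) \<Rightarrow> bool" where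
  "wiener_pair W Y y \<longleftrightarrow> (\<exists>s t. s < t \<and> Y = (\<lambda>\<omega>. W t \<omega> - W s \<omega>) \<and> y = indicator {s<..t})"

lemma brownian_motion_increment:
  assumes W: "brownian_motion M W"
  shows "(\<lambda>\<omega>. W t \<omega> - W s \<omega>) \<in> L2_functions M" "(\<integral>\<omega>. (W t \<omega> - W s \<omega>)\<^sup>2 \<partial>M) = \<bar>t - s\<bar>"
proof -
  interpret prob_space M using W by (simp add: brownian_motion_def)
  have [measurable]: "W t \<in> borel_measurable M" for t using W by (simp add: brownian_motion_def)
  have *: "integrable M (\<lambda>\<omega>. (W t \<omega> - W s \<omega>)\<^sup>2) \<and> (\<integral>\<omega>. (W t \<omega> - W s \<omega>)\<^sup>2 \<partial>M) = t - s" if "s < t" for s t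
  proof -
    have D: "distributed M lborel (\<lambda>\<omega>. W t \<omega> - W s \<omega>) (normal_density 0 (sqrt (t - s)))"
      using W that by (simp add: brownian_motion_def)
    have m: "has_bochner_integral lborel (\<lambda>x. normal_density 0 (sqrt (t - s)) x * (x - 0)^(2*1)) (fact (2 * 1) / ((2 / (sqrt (t - s))\<^sup>2)^1 * fact 1))"
      using that by (intro normal_moment_even) auto
    have "integrable lborel (\<lambda>x. normal_density 0 (sqrt (t - s)) x * x\<^sup>2)"
      using m by (auto simp: has_bochner_integral_iff)
    then have "integrable M (\<lambda>\<omega>. (W t \<omega> - W s \<omega>)\<^sup>2)"
      by (subst distributed_integrable[OF D, symmetric]) auto
    moreover have "(\<integral>\<omega>. (W t \<omega> - W s \<omega>)\<^sup>2 \<partial>M) = (\<integral>x. normal_density 0 (sqrt (t - s)) x * x\<^sup>2 \<partial>lborel)"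
      by (subst distributed_integral[OF D, symmetric]) auto
    ultimately show ?thesis
      using m that by (auto simp: has_bochner_integral_iff)
  qed
  have "integrable M (\<lambda>\<omega>. (W t \<omega> - W s \<omega>)\<^sup>2) \<and> (\<integral>\<omega>. (W t \<omega> - W s \<omega>)\<^sup>2 \<partial>M) = \<bar>t - s\<bar>"
    using *[of s t] *[of t s] by (cases s t rule: linorder_cases) (auto simp: power2_commute)
  then show "(\<lambda>\<omega>. W t \<omega> - W s \<omega>) \<in> L2_functions M" "(\<integral>\<omega>. (W t \<omega> - W s \<omega>)\<^sup>2 \<partial>M) = \<bar>t - s\<bar>"
    by (auto simp: L2_functions_def)
qed

lemma indicator_Ioc_L2: "indicator {s<..t::real} \<in> L2_functions lborel"
proof -
  have "emeasure lborel {s<..t} < \<infinity>" by (cases "s \<le> t") auto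
  then show ?thesis
    by (simp add: L2_functions_def power2_eq_square integrable_real_indicator flip: indicator_inter_arith)
qed

lemma wiener_pair_L2:
  assumes "brownian_motion M W" "wiener_pair W Y y"
  shows "Y \<in> L2_functions M \<and> y \<in> L2_functions lborel"
proof -
  obtain s t where "Y = (\<lambda>\<omega>. W t \<omega> - W s \<omega>)" "y = indicator {s<..t}"
    using assms(2) by (auto simp: wiener_pair_def)
  then show ?thesis
    using brownian_motion_increment(1)[OF assms(1), of t s] indicator_Ioc_L2[of s t] by simp
qed

text \<open>
  The second moments \<open>\<bar>t - s\<bar>\<close> of the increments already determine the inner products, by
  polarisation: a product of two increments is a combination of four squared increments.
\<close>

lemma wiener_pair_inner:
  assumes W: "brownian_motion M W" and "wiener_pair W Y y" "wiener_pair W Z z"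
  shows "(\<integral>x. Y x * Z x \<partial>M) = (\<integral>x. y x * z x \<partial>lborel)"
proof -
  obtain s t u v where st: "s < t" "Y = (\<lambda>\<omega>. W t \<omega> - W s \<omega>)" "y = indicator {s<..t}"
    and uv: "u < v" "Z = (\<lambda>\<omega>. W v \<omega> - W u \<omega>)" "z = indicator {u<..v}"
    using assms by (auto simp: wiener_pair_def)
  note i = L2_functionsD(2)[OF brownian_motion_increment(1)[OF W]]
  have "Y \<omega> * Z \<omega> = ((W t \<omega> - W u \<omega>)\<^sup>2 + (W s \<omega> - W v \<omega>)\<^sup>2 - (W t \<omega> - W v \<omega>)\<^sup>2 - (W s \<omega> - W u \<omega>)\<^sup>2) / 2" for \<omega>
    by (simp add: st uv power2_eq_square field_simps)
  then have "(\<integral>x. Y x * Z x \<partial>M) = (\<integral>\<omega>. ((W t \<omega> - W u \<omega>)\<^sup>2 + (W s \<omega> - W v \<omega>)\<^sup>2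
      - (W t \<omega> - W v \<omega>)\<^sup>2 - (W s \<omega> - W u \<omega>)\<^sup>2) / 2 \<partial>M)"
    by (intro Bochner_Integration.integral_cong) auto
  also have "\<dots> = (\<bar>t - u\<bar> + \<bar>s - v\<bar> - \<bar>t - v\<bar> - \<bar>s - u\<bar>) / 2"
    using i by (simp add: brownian_motion_increment(2)[OF W])
  also have "\<dots> = max 0 (min t v - max s u)"
    using st(1) uv(1) by (simp add: min_def max_def abs_if)
  also have "\<dots> = measure lborel ({s<..t} \<inter> {u<..v})"
    by (cases "max s u \<le> min t v") auto
  also have "\<dots> = (\<integral>x. y x * z x \<partial>lborel)"
    by (simp only: st uv flip: indicator_inter_arith) simp
  finally show ?thesis .
qed

lemma wiener_integral_isometric_closure:
  assumes "has_wiener_integral M W f Y"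
  shows "isometric_closure M lborel (wiener_pair W) Y f"
proof -
  obtain \<phi> Z where a: "\<And>n. has_simple_integral W UNIV (\<phi> n) (Z n)" "L2_lim lborel \<phi> f" "L2_lim M Z Y"
    using assms by (auto simp: has_wiener_integral_def)
  have "isometric_closure M lborel (wiener_pair W) (Z n) (\<phi> n)" for n
  proof -
    obtain m t a where t: "\<forall>k<m. t k < t (Suc k)" 
      and e: "\<phi> n = (\<lambda>x. \<Sum>k<m. a k * indicator {t k<..t (Suc k)} x)"
        "Z n = (\<lambda>\<omega>. \<Sum>k<m. a k * (W (t (Suc k)) \<omega> - W (t k) \<omega>))"
      using a(1)[of n] unfolding has_simple_integral_def by (elim exE conjE) (rule that)
    show ?thesis unfolding e
      using t by (intro isometric_closure_sum isometric_closure.base) (auto simp: wiener_pair_def)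
  qed
  with a(2,3) show ?thesis by (blast intro: isometric_closure.lim)
qed

section \<open>Laplace transforms of measures on the half-line\<close>

lemma nn_integral_exp_pos: "(\<integral>\<^sup>+t\<in>{0<..}. ennreal (exp (- t * a)) \<partial>lborel) = ennreal (1 / a)" if "0 < a" for a :: real
proof -
  have "emeasure (density lborel (exponential_density a)) UNIV = 1"
    using prob_space.emeasure_space_1[OF prob_space_exponential_density[OF that]] by simp
  then have "1 = (\<integral>\<^sup>+t. ennreal (exponential_density a t) \<partial>lborel)"
    by (simp add: emeasure_density)
  also have "\<dots> = (\<integral>\<^sup>+t. ennreal a * (ennreal (exp (- t * a)) * indicator {0<..} t) \<partial>lborel)"
    using AE_lborel_singleton[of 0]
    by (intro nn_integral_cong_AE, eventually_elim)
       (use that in \<open>auto simp: exponential_density_def indicator_def ennreal_mult\<close>)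
  also have "\<dots> = ennreal a * (\<integral>\<^sup>+t. ennreal (exp (- t * a)) * indicator {0<..} t \<partial>lborel)"
    by (rule nn_integral_cmult) measurable
  finally have e: "ennreal a * (\<integral>\<^sup>+t. ennreal (exp (- t * a)) * indicator {0<..} t \<partial>lborel) = 1" by simp
  have "ennreal (1/a) * (ennreal a * x) = x" for x
    using that by (simp flip: mult.assoc ennreal_mult)
  from this[of "(\<integral>\<^sup>+t. ennreal (exp (- t * a)) * indicator {0<..} t \<partial>lborel)"] show ?thesis
    unfolding e by simp
qed

text \<open>
  These turn the single condition that \<open>1 / (1 + s)\<close> is integrable into integrability of the
  exponentials and of their derivatives; the second follows by writing \<open>exp (- t s)\<close> as a square.
\<close>

lemma exp_bound:
  fixes s t :: real
  assumes "0 < s" "0 < t"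
  shows "exp (- t * s) \<le> (1 + 1 / t) * (1 / (1 + s))"
    and "s * exp (- t * s) \<le> (2 / t) * (1 + 2 / t) * (1 / (1 + s))"
proof -
  have 1: "s * exp (- t * s) \<le> 1 / t" if "0 < t" for t
  proof -
    have "t * s \<le> exp (t * s)" using exp_ge_add_one_self[of "t * s"] by linarith
    then show ?thesis using that by (simp add: exp_minus field_simps)
  qed
  have 2: "exp (- t * s) \<le> (1 + 1 / t) * (1 / (1 + s))" if "0 < t" for t
  proof -
    have "(1 + s) * exp (- t * s) = exp (- t * s) + s * exp (- t * s)" by (simp add: algebra_simps)
    also have "\<dots> \<le> 1 + 1 / t" using 1[OF that] that assms by (intro add_mono) auto
    finally show ?thesis using assms by (simp add: field_simps)
  qed
  show "exp (- t * s) \<le> (1 + 1 / t) * (1 / (1 + s))" by (rule 2) fact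
  have "s * exp (- t * s) = (s * exp (- (t/2) * s)) * exp (- (t/2) * s)"
    by (simp flip: exp_add)
  also have "\<dots> \<le> (1 / (t/2)) * ((1 + 1 / (t/2)) * (1 / (1 + s)))"
    using assms by (intro mult_mono 1 2) auto
  finally show "s * exp (- t * s) \<le> (2 / t) * (1 + 2 / t) * (1 / (1 + s))" by (simp add: mult.assoc)
qed

locale laplace_measure =
  fixes \<rho> :: "real measure"
  assumes on_pos: "borel_measure_on_pos \<rho>"
    and fin: "(\<integral>\<^sup>+s. ennreal (1 / (1 + s)) \<partial>\<rho>) < \<infinity>"
begin

lemma sets_rho: "sets \<rho> = sets (restrict_space borel {0<..})"
  using on_pos by (simp add: borel_measure_on_pos_def)

lemma space_rho: "space \<rho> = {0<..}"
  using sets_eq_imp_space_eq[OF sets_rho] by (simp add: space_restrict_space)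

lemma measurable_rho: "f \<in> borel_measurable borel \<Longrightarrow> f \<in> borel_measurable \<rho>"
  by (subst measurable_cong_sets[OF sets_rho refl]) (rule measurable_restrict_space1)

lemma integrable_one: "integrable \<rho> (\<lambda>s. 1 / (1 + s))"
proof (rule integrableI_nonneg)
  show "(\<lambda>s. 1 / (1 + s)) \<in> borel_measurable \<rho>" by (rule measurable_rho) measurable
  show "AE s in \<rho>. 0 \<le> 1 / (1 + s)" by (rule AE_I2) (simp add: space_rho)
qed (rule fin)

lemma sigma_finite: "sigma_finite_measure \<rho>"
proof
  show "\<exists>A. countable A \<and> A \<subseteq> sets \<rho> \<and> \<Union> A = space \<rho> \<and> (\<forall>a\<in>A. emeasure \<rho> a \<noteq> \<infinity>)"
  proof (intro exI conjI ballI)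
    let ?A = "range (\<lambda>n::nat. {0<..real n})"
    have s: "{0<..real n} \<in> sets \<rho>" for n
      by (auto simp: sets_rho sets_restrict_space_iff)
    show "countable ?A" by auto
    show "?A \<subseteq> sets \<rho>" using s by auto
    show "\<Union> ?A = space \<rho>"
      using real_arch_simple by (auto simp: space_rho)
    fix a assume "a \<in> ?A"
    then obtain n :: nat where a: "a = {0<..real n}" by auto
    have "emeasure \<rho> a = (\<integral>\<^sup>+s. indicator a s \<partial>\<rho>)" using s a by simp
    also have "\<dots> \<le> (\<integral>\<^sup>+s. ennreal (1 + n) * ennreal (1 / (1 + s)) \<partial>\<rho>)"
    proof (rule nn_integral_mono)
      fix s assume "s \<in> space \<rho>"
      then have "1 \<le> (1 + real n) * (1 / (1 + s))" if "s \<in> a"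
        using that a by (simp add: space_rho field_simps)
      then show "indicator a s \<le> ennreal (1 + n) * ennreal (1 / (1 + s))"
        using \<open>s \<in> space \<rho>\<close>
        by (cases "s \<in> a") (auto simp: space_rho simp del: ennreal_plus simp flip: ennreal_mult)
    qed
    also have "\<dots> = ennreal (1 + n) * (\<integral>\<^sup>+s. ennreal (1 / (1 + s)) \<partial>\<rho>)"
      by (rule nn_integral_cmult, rule measurable_rho) measurable
    also have "\<dots> < \<infinity>" using fin by (simp add: ennreal_mult_less_top)
    finally show "emeasure \<rho> a \<noteq> \<infinity>" by simp
  qed
qed

lemma integrable_exp: "0 < t \<Longrightarrow> integrable \<rho> (\<lambda>s. exp (- t * s))"
  using exp_bound(1)
  by (intro Bochner_Integration.integrable_bound[OF integrable_mult_right[OF integrable_one, of "1 + 1/t"]])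
     (auto intro!: AE_I2 measurable_rho simp: space_rho)

lemma integrable_s_exp: "0 < t \<Longrightarrow> integrable \<rho> (\<lambda>s. s * exp (- t * s))"
  using exp_bound(2)
  by (intro Bochner_Integration.integrable_bound[OF integrable_mult_right[OF integrable_one, of "(2 / t) * (1 + 2 / t)"]])
     (auto intro!: AE_I2 measurable_rho simp: space_rho)

lemma MA_coeff_pos: "0 < t \<Longrightarrow> MA_coeff \<rho> t = (\<integral>s. exp (- t * s) \<partial>\<rho>)"
  by (simp add: MA_coeff_def)

lemma MA_coeff_nonpos: "t \<le> 0 \<Longrightarrow> MA_coeff \<rho> t = 0"
  by (simp add: MA_coeff_def)

lemma MA_coeff_nonneg: "0 \<le> MA_coeff \<rho> t"
  by (simp add: MA_coeff_def integral_nonneg_AE)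

lemma ennreal_MA_coeff: "0 < t \<Longrightarrow> ennreal (MA_coeff \<rho> t) = (\<integral>\<^sup>+s. ennreal (exp (- t * s)) \<partial>\<rho>)"
  using integrable_exp[of t] by (simp add: MA_coeff_pos nn_integral_eq_integral)

lemma MA_coeff_antimono: "0 < s \<Longrightarrow> s \<le> t \<Longrightarrow> MA_coeff \<rho> t \<le> MA_coeff \<rho> s"
  unfolding MA_coeff_pos using integrable_exp
  by (simp add: MA_coeff_pos) (rule integral_mono, auto simp: space_rho)

lemma MA_coeff_measurable [measurable]: "MA_coeff \<rho> \<in> borel_measurable borel"
proof -
  interpret sigma_finite_measure \<rho> by (rule sigma_finite)
  have m: "(\<lambda>t. \<integral>s. exp (- t * s) \<partial>\<rho>) \<in> borel_measurable borel"
  proof (rule borel_measurable_lebesgue_integral)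
    have [measurable]: "snd \<in> borel_measurable ((borel :: real measure) \<Otimes>\<^sub>M \<rho>)"
      by (rule measurable_compose[OF measurable_snd measurable_rho]) auto
    show "(\<lambda>(t, s). exp (- t * s)) \<in> borel_measurable ((borel :: real measure) \<Otimes>\<^sub>M \<rho>)"
      unfolding split_beta' by measurable
  qed
  have "MA_coeff \<rho> = (\<lambda>t. if t > 0 then \<integral>s. exp (- t * s) \<partial>\<rho> else 0)"
    by (auto simp: MA_coeff_def)
  also have "\<dots> \<in> borel_measurable borel" using m by measurable
  finally show ?thesis .
qed

text \<open>
  By Tonelli the integral equals that of \<open>1 / (1 + s)\<close>, as the exponential of rate \<open>1 + s\<close> has
  integral \<open>1 / (1 + s)\<close>. Local integrability at \<open>0\<close> follows from it.
\<close>

lemma nn_integral_exp_MA_coeff: "(\<integral>\<^sup>+t. ennreal (exp (- t)) * ennreal (MA_coeff \<rho> t) \<partial>lborel) < \<infinity>"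
proof -
  interpret sigma_finite_measure \<rho> by (rule sigma_finite)
  interpret pair_sigma_finite lborel \<rho> ..
  have [measurable]: "snd \<in> borel_measurable ((borel :: real measure) \<Otimes>\<^sub>M \<rho>)"
    by (rule measurable_compose[OF measurable_snd measurable_rho]) auto
  have "(\<integral>\<^sup>+t. ennreal (exp (- t)) * ennreal (MA_coeff \<rho> t) \<partial>lborel)
      = (\<integral>\<^sup>+t. \<integral>\<^sup>+s. ennreal (exp (- t * (1 + s))) * indicator {0<..} t \<partial>\<rho> \<partial>lborel)"
  proof (rule nn_integral_cong)
    fix t :: real
    show "ennreal (exp (- t)) * ennreal (MA_coeff \<rho> t) = (\<integral>\<^sup>+s. ennreal (exp (- t * (1 + s))) * indicator {0<..} t \<partial>\<rho>)"
    proof (cases "0 < t")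
      case True
      have "ennreal (exp (- t)) * ennreal (MA_coeff \<rho> t) = (\<integral>\<^sup>+s. ennreal (exp (- t)) * ennreal (exp (- t * s)) \<partial>\<rho>)"
        unfolding ennreal_MA_coeff[OF True] by (rule nn_integral_cmult[symmetric], rule measurable_rho) measurable
      then show ?thesis using True by (simp add: algebra_simps flip: ennreal_mult exp_add)
    qed (simp add: MA_coeff_nonpos)
  qed
  also have "\<dots> = (\<integral>\<^sup>+s. \<integral>\<^sup>+t. ennreal (exp (- t * (1 + s))) * indicator {0<..} t \<partial>lborel \<partial>\<rho>)"
    by (rule Fubini'[symmetric]) (auto simp: split_beta')
  also have "\<dots> = (\<integral>\<^sup>+s. ennreal (1 / (1 + s)) \<partial>\<rho>)"
    by (intro nn_integral_cong nn_integral_exp_pos) (auto simp: space_rho)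
  also have "\<dots> < \<infinity>" by (rule fin)
  finally show ?thesis .
qed

lemma nn_integral_MA_coeff_finite: "(\<integral>\<^sup>+t\<in>{..L}. ennreal (MA_coeff \<rho> t) \<partial>lborel) < \<infinity>"
proof -
  have "(\<integral>\<^sup>+t\<in>{..L}. ennreal (MA_coeff \<rho> t) \<partial>lborel)
    \<le> (\<integral>\<^sup>+t. ennreal (exp L) * (ennreal (exp (- t)) * ennreal (MA_coeff \<rho> t)) \<partial>lborel)"
  proof (rule nn_integral_mono)
    fix t
    show "ennreal (MA_coeff \<rho> t) * indicator {..L} t \<le> ennreal (exp L) * (ennreal (exp (- t)) * ennreal (MA_coeff \<rho> t))"
    proof (cases "t \<le> L")
      case True
      then have "1 * MA_coeff \<rho> t \<le> exp (L - t) * MA_coeff \<rho> t"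
        by (intro mult_right_mono MA_coeff_nonneg) auto
      then show ?thesis using True MA_coeff_nonneg[of t]
        by (simp add: exp_diff exp_minus field_simps flip: ennreal_mult)
    qed simp
  qed
  also have "\<dots> = ennreal (exp L) * (\<integral>\<^sup>+t. ennreal (exp (- t)) * ennreal (MA_coeff \<rho> t) \<partial>lborel)"
    by (rule nn_integral_cmult) measurable
  also have "\<dots> < \<infinity>" using nn_integral_exp_MA_coeff by (simp add: ennreal_mult_less_top)
  finally show ?thesis .
qed

text \<open>
  Minus the derivative of the Laplace transform, see \<open>MA_coeff_has_derivative\<close>.
\<close>

definition neg_deriv :: "real \<Rightarrow> real" where
  "neg_deriv t = (\<integral>s. s * exp (- t * s) \<partial>\<rho>)"

lemma neg_deriv_nonneg: "0 \<le> neg_deriv t"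
  unfolding neg_deriv_def by (intro integral_nonneg_AE AE_I2) (simp add: space_rho)

lemma neg_deriv_antimono: "0 < s \<Longrightarrow> s \<le> t \<Longrightarrow> neg_deriv t \<le> neg_deriv s"
  unfolding neg_deriv_def using integrable_s_exp
  by (intro integral_mono) (auto simp: space_rho)

lemma neg_deriv_measurable [measurable]: "neg_deriv \<in> borel_measurable borel"
proof -
  interpret sigma_finite_measure \<rho> by (rule sigma_finite)
  show ?thesis
    unfolding neg_deriv_def
  proof (rule borel_measurable_lebesgue_integral)
    have [measurable]: "snd \<in> borel_measurable ((borel :: real measure) \<Otimes>\<^sub>M \<rho>)"
      by (rule measurable_compose[OF measurable_snd measurable_rho]) auto
    show "(\<lambda>(t, s). s * exp (- t * s)) \<in> borel_measurable ((borel :: real measure) \<Otimes>\<^sub>M \<rho>)"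
      unfolding split_beta' by measurable
  qed
qed

lemma integrable_MA_coeff: "integrable lborel (\<lambda>t. indicator {..<x} t * MA_coeff \<rho> t)"
proof (rule integrableI_bounded)
  have "(\<integral>\<^sup>+t. ennreal (norm (indicator {..<x} t * MA_coeff \<rho> t)) \<partial>lborel)
      \<le> (\<integral>\<^sup>+t\<in>{..x}. ennreal (MA_coeff \<rho> t) \<partial>lborel)"
    by (intro nn_integral_mono) (auto simp: indicator_def MA_coeff_nonneg)
  also have "\<dots> < \<infinity>" by (rule nn_integral_MA_coeff_finite)
  finally show "(\<integral>\<^sup>+t. ennreal (norm (indicator {..<x} t * MA_coeff \<rho> t)) \<partial>lborel) < \<infinity>" .
qed measurable

text \<open>
  Integrating over all of \<open>{..<x}\<close> is harmless since the coefficient vanishes on the negative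
  half-line, and it avoids a case distinction on the sign of \<open>x\<close>.
\<close>

lemma MA_primitive_eq: "MA_primitive \<rho> x = (LBINT t. indicator {..<x} t * MA_coeff \<rho> t)"
proof -
  have "MA_primitive \<rho> x = (LBINT t:einterval 0 x. MA_coeff \<rho> t)"
  proof (cases "0 \<le> x")
    case False
    then have "MA_primitive \<rho> x = 0" "(LBINT t:einterval 0 x. MA_coeff \<rho> t) = 0"
      by (auto simp: MA_primitive_def interval_lebesgue_integral_def set_lebesgue_integral_def
          einterval_def indicator_def MA_coeff_nonpos zero_ereal_def cong: Bochner_Integration.integral_cong
          intro!: Bochner_Integration.integral_eq_zero_AE AE_I2)
    then show ?thesis by simp
  qed (simp add: MA_primitive_def interval_lebesgue_integral_def zero_ereal_def)
  also have "\<dots> = (LBINT t. indicator {..<x} t * MA_coeff \<rho> t)"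
    unfolding set_lebesgue_integral_def
    by (intro Bochner_Integration.integral_cong)
       (auto simp: einterval_def indicator_def zero_ereal_def MA_coeff_nonpos)
  finally show ?thesis .
qed

lemma MA_primitive_nn: "ennreal (MA_primitive \<rho> x) = (\<integral>\<^sup>+t. ennreal (MA_coeff \<rho> t) * indicator {..<x} t \<partial>lborel)"
  unfolding MA_primitive_eq
  by (subst nn_integral_eq_integral[OF integrable_MA_coeff, symmetric])
     (auto intro!: nn_integral_cong simp: MA_coeff_nonneg indicator_def)

lemma MA_primitive_nonneg: "0 \<le> MA_primitive \<rho> x"
  unfolding MA_primitive_eq by (intro integral_nonneg_AE AE_I2) (simp add: MA_coeff_nonneg)

lemma MA_primitive_nonpos: "x \<le> 0 \<Longrightarrow> MA_primitive \<rho> x = 0"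
  unfolding MA_primitive_eq
  by (intro integral_eq_zero_AE AE_I2) (auto simp: indicator_def MA_coeff_nonpos)

lemma MA_primitive_diff:
  assumes "x \<le> y"
  shows "integrable lborel (\<lambda>t. indicator {x..<y} t * MA_coeff \<rho> t)"
    and "MA_primitive \<rho> y - MA_primitive \<rho> x = (LBINT t. indicator {x..<y} t * MA_coeff \<rho> t)"
proof -
  have *: "(\<lambda>t. indicator {x..<y} t * MA_coeff \<rho> t) =
      (\<lambda>t. indicator {..<y} t * MA_coeff \<rho> t - indicator {..<x} t * MA_coeff \<rho> t)"
    using assms by (auto simp: fun_eq_iff indicator_def)
  show "integrable lborel (\<lambda>t. indicator {x..<y} t * MA_coeff \<rho> t)"
    unfolding * by (intro Bochner_Integration.integrable_diff integrable_MA_coeff)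
  show "MA_primitive \<rho> y - MA_primitive \<rho> x = (LBINT t. indicator {x..<y} t * MA_coeff \<rho> t)"
    unfolding * MA_primitive_eq by (rule Bochner_Integration.integral_diff[symmetric]; rule integrable_MA_coeff)
qed

lemma MA_primitive_mono:
  assumes "x \<le> y"
  shows "MA_primitive \<rho> x \<le> MA_primitive \<rho> y"
proof -
  have "0 \<le> (LBINT t. indicator {x..<y} t * MA_coeff \<rho> t)"
    by (intro integral_nonneg_AE AE_I2) (simp add: MA_coeff_nonneg)
  then show ?thesis using MA_primitive_diff(2)[OF assms] by simp
qed

lemma MA_primitive_measurable [measurable]: "MA_primitive \<rho> \<in> borel_measurable borel"
  by (intro borel_measurable_mono monoI MA_primitive_mono)

lemma MA_primitive_diff_le:
  assumes "0 < x" "0 \<le> L"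
  shows "MA_primitive \<rho> (x + L) - MA_primitive \<rho> x \<le> L * MA_coeff \<rho> x"
proof -
  have "MA_primitive \<rho> (x + L) - MA_primitive \<rho> x \<le> (LBINT t. indicator {x..<x+L} t * MA_coeff \<rho> x)"
    unfolding MA_primitive_diff(2)[of x "x + L", simplified, OF assms(2)]
  proof (rule integral_mono)
    show "integrable lborel (\<lambda>t. indicator {x..<x+L} t * MA_coeff \<rho> t)"
      using assms by (intro MA_primitive_diff) auto
    show "integrable lborel (\<lambda>t. indicator {x..<x+L} t * MA_coeff \<rho> x)"
      using assms by (intro integrable_mult_left integrable_real_indicator) auto
    show "indicator {x..<x+L} t * MA_coeff \<rho> t \<le> indicator {x..<x+L} t * MA_coeff \<rho> x" for t
      using MA_coeff_antimono[of x t] assms by (auto simp: indicator_def)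
  qed
  then show ?thesis using assms by simp
qed

text \<open>
  Differentiation under the integral. By the mean value theorem a difference quotient with step
  less than \<open>t / 2\<close> is dominated by \<open>s exp (- t s / 2)\<close>, which is integrable.
\<close>

lemma MA_coeff_has_derivative:
  assumes t: "0 < t"
  shows "(MA_coeff \<rho> has_real_derivative - neg_deriv t) (at t)"
  unfolding has_field_derivative_def[symmetric] DERIV_def tendsto_at_iff_sequentially
proof (intro allI impI)
  fix h :: "nat \<Rightarrow> real" assume h0: "\<forall>i. h i \<in> UNIV - {0}" and h: "h \<longlonglongrightarrow> 0"
  have "\<forall>\<^sub>F i in sequentially. \<bar>h i\<bar> < t / 2"
    using t by (intro order_tendstoD(2)[OF tendsto_rabs_zero[OF h]]) auto
  then obtain K where K: "\<And>i. i \<ge> K \<Longrightarrow> \<bar>h i\<bar> < t / 2" by (auto simp: eventually_sequentially)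
  define q where "q i s = (exp (- (t + h (i + K)) * s) - exp (- t * s)) / h (i + K)" for i s
  have hK: "\<bar>h (i + K)\<bar> < t / 2" "h (i + K) \<noteq> 0" for i using K[of "i + K"] h0 by auto
  have "(\<lambda>i. \<integral>s. q i s \<partial>\<rho>) \<longlonglongrightarrow> (\<integral>s. - (s * exp (- t * s)) \<partial>\<rho>)"
  proof (rule integral_dominated_convergence)
    show "(\<lambda>s. - (s * exp (- t * s))) \<in> borel_measurable \<rho>" "\<And>i. q i \<in> borel_measurable \<rho>"
      unfolding q_def by (rule measurable_rho, measurable)+
    show "integrable \<rho> (\<lambda>s. s * exp (- (t/2) * s))" using t by (intro integrable_s_exp) auto
    show "AE s in \<rho>. (\<lambda>i. q i s) \<longlonglongrightarrow> - (s * exp (- t * s))"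
    proof (rule AE_I2)
      fix s assume "s \<in> space \<rho>"
      have "((\<lambda>x. exp (- x * s)) has_real_derivative - (s * exp (- t * s))) (at t)"
        by (auto intro!: derivative_eq_intros)
      then have "((\<lambda>k. (exp (- (t + k) * s) - exp (- t * s)) / k) \<longlongrightarrow> - (s * exp (- t * s))) (at 0)"
        by (simp only: DERIV_def)
      moreover have "filterlim (\<lambda>i. h (i + K)) (at 0) sequentially"
        using hK(2) LIMSEQ_ignore_initial_segment[OF h] by (auto simp: filterlim_at)
      ultimately show "(\<lambda>i. q i s) \<longlonglongrightarrow> - (s * exp (- t * s))"
        unfolding q_def by (rule filterlim_compose)
    qed
    show "AE s in \<rho>. norm (q i s) \<le> s * exp (- (t/2) * s)" for i
    proof (rule AE_I2)
      fix s assume "s \<in> space \<rho>"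
      then have s: "0 < s" by (simp add: space_rho)
      let ?k = "h (i + K)"
      have "\<exists>z. exp (- (t + ?k) * s) - exp (- t * s) = - (?k * s) * exp z \<and> z \<le> - (t/2) * s"
      proof -
        have ex: "\<exists>z. x < z \<and> z < y \<and> exp y - exp x = (y - x) * exp z" if "x < y" for x y :: real
          using MVT2[OF that, of exp exp] by (auto intro: derivative_eq_intros)
        have b: "- (t + ?k) * s \<le> - (t/2) * s" "- t * s \<le> - (t/2) * s"
          using hK(1)[of i] s t by (intro mult_right_mono; simp add: abs_if split: if_splits)+
        have "- (t + ?k) * s \<noteq> - t * s"
          using hK(2)[of i] s by (simp only: mult_cancel_right) simp
        then consider "- (t + ?k) * s < - t * s" | "- t * s < - (t + ?k) * s"
          by (rule linorder_neqE)
        then show ?thesis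
        proof cases
          case 1
          then obtain z where "z < - t * s" "exp (- t * s) - exp (- (t + ?k) * s) = (- t * s - - (t + ?k) * s) * exp z"
            using ex by blast
          with b show ?thesis by (intro exI[of _ z]) (auto simp: algebra_simps)
        next
          case 2
          then obtain z where "z < - (t + ?k) * s" "exp (- (t + ?k) * s) - exp (- t * s) = (- (t + ?k) * s - - t * s) * exp z"
            using ex by blast
          with b show ?thesis by (intro exI[of _ z]) (auto simp: algebra_simps)
        qed
      qed
      then obtain z where z: "exp (- (t + ?k) * s) - exp (- t * s) = - (?k * s) * exp z" "z \<le> - (t/2) * s" by blast
      have "norm (q i s) = s * exp z"
        unfolding q_def z(1) using s hK(2)[of i] by (simp add: abs_mult)
      also have "\<dots> \<le> s * exp (- (t/2) * s)" using s z(2) by (intro mult_left_mono) auto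
      finally show "norm (q i s) \<le> s * exp (- (t/2) * s)" .
    qed
  qed
  moreover have "(\<integral>s. q i s \<partial>\<rho>) = (MA_coeff \<rho> (t + h (i + K)) - MA_coeff \<rho> t) / h (i + K)" for i
  proof -
    have "0 < t + h (i + K)" using hK(1)[of i] t by (auto simp: abs_if split: if_splits)
    then show ?thesis unfolding q_def using t integrable_exp[of "t + h (i + K)"] integrable_exp[of t]
      by (simp add: MA_coeff_pos del: mult_minus_left minus_add_distrib)
  qed
  ultimately have "(\<lambda>i. (MA_coeff \<rho> (t + h (i + K)) - MA_coeff \<rho> t) / h (i + K)) \<longlonglongrightarrow> - neg_deriv t"
    unfolding neg_deriv_def by simp
  then have "(\<lambda>i. (MA_coeff \<rho> (t + h i) - MA_coeff \<rho> t) / h i) \<longlonglongrightarrow> - neg_deriv t"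
    by (rule LIMSEQ_offset)
  then show "((\<lambda>h. (MA_coeff \<rho> (t + h) - MA_coeff \<rho> t) / h) \<circ> h) \<longlonglongrightarrow> - neg_deriv t"
    by (simp add: o_def)
qed

lemma AR_alpha_eq: "0 < t \<Longrightarrow> AR_alpha \<rho> t = MA_coeff \<rho> t"
  by (simp add: AR_alpha_def MA_coeff_pos mult.commute)

lemma AR_coeff_eq:
  assumes "0 < t"
  shows "AR_coeff \<rho> t = neg_deriv t"
proof -
  have "(AR_alpha \<rho> has_real_derivative - neg_deriv t) (at t)"
    by (rule has_field_derivative_transform_within_open[OF MA_coeff_has_derivative[OF assms], of "{0<..}"])
       (use assms in \<open>auto simp: AR_alpha_eq\<close>)
  then show ?thesis by (simp add: AR_coeff_def DERIV_imp_deriv)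
qed

end

section \<open>Convolutions and uniqueness of Laplace transforms\<close>

text \<open>
  With values in the extended nonnegative reals the convolution of measurable functions always
  exists and is commutative and associative, even where it is infinite. Functions on the half-line enter as functions
  that vanish on the negative numbers.
\<close>

definition conv :: "(real \<Rightarrow> ennreal) \<Rightarrow> (real \<Rightarrow> ennreal) \<Rightarrow> real \<Rightarrow> ennreal" where
  "conv F G x = (\<integral>\<^sup>+u. F u * G (x - u) \<partial>lborel)"

lemma conv_measurable [measurable]:
  assumes [measurable]: "F \<in> borel_measurable borel" "G \<in> borel_measurable borel"
  shows "conv F G \<in> borel_measurable borel"
  unfolding conv_def by measurable

lemma conv_commute:
  assumes [measurable]: "F \<in> borel_measurable borel" "G \<in> borel_measurable borel"
  shows "conv F G x = conv G F x"
  unfolding conv_def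
  by (subst nn_integral_real_affine[where c="-1" and t=x]) (auto simp: mult.commute)

lemma nn_integral_shift:
  assumes [measurable]: "(F :: real \<Rightarrow> ennreal) \<in> borel_measurable borel"
  shows "(\<integral>\<^sup>+u. F (a + u) \<partial>lborel) = (\<integral>\<^sup>+u. F u \<partial>lborel)"
  by (subst (2) nn_integral_real_affine[where c=1 and t=a]) auto

lemma conv_assoc:
  assumes [measurable]: "F \<in> borel_measurable borel" "G \<in> borel_measurable borel" "H \<in> borel_measurable borel"
  shows "conv (conv F G) H x = conv F (conv G H) x"
proof -
  have "conv (conv F G) H x = (\<integral>\<^sup>+v. \<integral>\<^sup>+u. F u * (G (v - u) * H (x - v)) \<partial>lborel \<partial>lborel)"
    unfolding conv_def by (simp add: nn_integral_multc[symmetric] mult.assoc)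
  also have "\<dots> = (\<integral>\<^sup>+u. \<integral>\<^sup>+v. F u * (G (v - u) * H (x - v)) \<partial>lborel \<partial>lborel)"
    by (rule lborel_pair.Fubini') measurable
  also have "\<dots> = (\<integral>\<^sup>+u. F u * (\<integral>\<^sup>+v. G (v - u) * H (x - v) \<partial>lborel) \<partial>lborel)"
    by (simp add: nn_integral_cmult)
  also have "\<dots> = (\<integral>\<^sup>+u. F u * (\<integral>\<^sup>+v. G v * H (x - u - v) \<partial>lborel) \<partial>lborel)"
    by (subst nn_integral_shift[where F="\<lambda>v. G (v - u) * H (x - v)" and a=u for u, symmetric]) (simp_all add: algebra_simps)
  finally show ?thesis by (simp add: conv_def)
qed

lemma conv_cong_AE_left:
  assumes "AE u in lborel. F u = G u"
  shows "conv F H x = conv G H x"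
  unfolding conv_def by (rule nn_integral_cong_AE) (use assms in auto)

lemma conv_cong_AE_right:
  assumes [measurable]: "F \<in> borel_measurable borel" "G \<in> borel_measurable borel" "H \<in> borel_measurable borel"
    and "AE u in lborel. F u = G u"
  shows "conv H F x = conv H G x"
  using conv_cong_AE_left[OF assms(4), of H x] by (simp add: conv_commute[of H])

lemma conv_add_left:
  assumes [measurable]: "F \<in> borel_measurable borel" "G \<in> borel_measurable borel" "H \<in> borel_measurable borel"
  shows "conv (\<lambda>u. F u + G u) H x = conv F H x + conv G H x"
  unfolding conv_def by (simp add: distrib_right nn_integral_add)

lemma conv_cmult_left:
  assumes [measurable]: "F \<in> borel_measurable borel" "H \<in> borel_measurable borel"
  shows "conv (\<lambda>u. a * F u) H x = a * conv F H x"
  unfolding conv_def by (simp add: mult.assoc nn_integral_cmult)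

lemma char_convolution:
  assumes M: "finite_measure M" "sets M = sets borel" and N: "finite_measure N" "sets N = sets borel"
  shows "char (M \<star> N) t = char M t * char N t"
proof -
  interpret M: finite_measure M by (rule M)
  interpret N: finite_measure N by (rule N)
  interpret pair_sigma_finite M N ..
  interpret P: finite_measure "M \<Otimes>\<^sub>M N" by (intro finite_measure_pair_measure M N)
  note [measurable_cong] = M(2) N(2)
  have i: "integrable (M \<Otimes>\<^sub>M N) (\<lambda>p. iexp (t * (fst p + snd p)))"
    by (rule P.integrable_const_bound[where B=1]) (auto intro!: AE_I2)
  have "char (M \<star> N) t = (CLINT p|M \<Otimes>\<^sub>M N. iexp (t * (fst p + snd p)))"
    unfolding char_def convolution_def by (subst integral_distr) (auto simp: split_beta')
  also have "\<dots> = (CLINT x|M. CLINT y|N. iexp (t * (x + y)))"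
    using integral_fst'[OF i] by simp
  also have "\<dots> = char M t * char N t"
    unfolding char_def by (simp add: distrib_left exp_add)
  finally show ?thesis .
qed

text \<open>
  Weighting with \<open>exp (- t)\<close> turns the Fourier transform on the line \<open>Im z = 1\<close> into the
  characteristic function of a finite measure.
\<close>

lemma char_exp_density:
  assumes [measurable]: "c \<in> borel_measurable borel" and c: "\<And>t. 0 \<le> c t" "\<And>t. t \<le> 0 \<Longrightarrow> c t = 0"
  shows "char (density lborel (\<lambda>t. ennreal (exp (- t) * c t))) x =
    (LBINT t:{0<..}. exp (\<i> * Complex x 1 * of_real t) * complex_of_real (c t))"
proof -
  have "char (density lborel (\<lambda>t. ennreal (exp (- t) * c t))) x = (LBINT t. (exp (- t) * c t) *\<^sub>R iexp (x * t))"
    unfolding char_def using c by (subst integral_density) auto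
  also have "\<dots> = (LBINT t:{0<..}. exp (\<i> * Complex x 1 * of_real t) * complex_of_real (c t))"
    unfolding set_lebesgue_integral_def
  proof (rule Bochner_Integration.integral_cong)
    fix t :: real
    have "\<i> * Complex x 1 * of_real t = \<i> * of_real (x * t) + of_real (- t)"
      by (simp add: complex_eq_iff)
    then have "exp (\<i> * Complex x 1 * of_real t) = iexp (x * t) * of_real (exp (- t))"
      by (simp only: exp_add exp_of_real)
    then show "(exp (- t) * c t) *\<^sub>R iexp (x * t) =
        indicator {0<..} t *\<^sub>R (exp (\<i> * Complex x 1 * of_real t) * complex_of_real (c t))"
      using c(2)[of t] by (cases "0 < t") (auto simp: scaleR_conv_of_real)
  qed simp
  finally show ?thesis .
qed

lemma einterval_0_infinity: "einterval 0 \<infinity> = {0<..}"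
  by (auto simp: einterval_def zero_ereal_def)

lemma char_exponential:
  "char (density lborel (\<lambda>t. ennreal (exp (- t) * indicator {0<..} t))) x = 1 / (1 - \<i> * x)"
proof -
  define w where "w = 1 - \<i> * complex_of_real x"
  have w0: "w \<noteq> 0" by (auto simp: w_def complex_eq_iff)
  have nrm: "norm (exp (- w * of_real t)) = exp (- t)" for t
    by (simp add: norm_exp_eq_Re w_def)
  have e: "\<i> * Complex x 1 * of_real t = - w * of_real t" for t
    by (simp add: complex_eq_iff w_def)
  have "char (density lborel (\<lambda>t. ennreal (exp (- t) * indicator {0<..} t))) x
      = (LBINT t:{0<..}. exp (- w * of_real t) * complex_of_real (indicator {0<..} t))"
    using char_exp_density[of "indicator {0<..}" x] unfolding e by simp
  also have "\<dots> = (LBINT t:{0<..}. exp (- w * of_real t))"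
    unfolding set_lebesgue_integral_def by (intro Bochner_Integration.integral_cong) (auto simp: indicator_def)
  also have "\<dots> = (LBINT t=0..\<infinity>. exp (- w * of_real t))"
    by (simp add: interval_lebesgue_integral_def einterval_0_infinity)
  also have "\<dots> = 0 - (- 1 / w)"
  proof (rule interval_integral_FTC_integrable[where F = "\<lambda>t. - exp (- w * of_real t) / w"])
    fix t :: real
    have "((\<lambda>z. - exp (- w * z) / w) has_field_derivative exp (- w * of_real t)) (at (of_real t))"
      using w0 by (auto intro!: derivative_eq_intros)
    from has_vector_derivative_real_field[OF this]
    show "((\<lambda>t. - exp (- w * of_real t) / w) has_vector_derivative exp (- w * of_real t)) (at t)" .
    show "isCont (\<lambda>t. exp (- w * complex_of_real t)) t" by (intro continuous_intros)
  next
    show "set_integrable lborel (einterval 0 \<infinity>) (\<lambda>t. exp (- w * complex_of_real t))"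
      unfolding set_integrable_def einterval_0_infinity
    proof (rule integrableI_bounded)
      have "(\<integral>\<^sup>+t. ennreal (norm (indicator {0<..} t *\<^sub>R exp (- w * complex_of_real t))) \<partial>lborel)
          = (\<integral>\<^sup>+t\<in>{0<..}. ennreal (exp (- t * 1)) \<partial>lborel)"
        using nrm by (intro nn_integral_cong) (auto simp: indicator_def simp del: norm_exp_eq_Re)
      also have "\<dots> < \<infinity>" using nn_integral_exp_pos[of 1] by simp
      finally show "(\<integral>\<^sup>+t. ennreal (norm (indicator {0<..} t *\<^sub>R exp (- w * complex_of_real t))) \<partial>lborel) < \<infinity>" .
    qed measurable
    show "(((\<lambda>t. - exp (- w * complex_of_real t) / w) \<circ> real_of_ereal) \<longlongrightarrow> - 1 / w) (at_right 0)"
      unfolding zero_ereal_def ereal_tendsto_simps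
      using w0 by (auto intro!: tendsto_eq_intros)
    show "(((\<lambda>t. - exp (- w * complex_of_real t) / w) \<circ> real_of_ereal) \<longlongrightarrow> 0) (at_left \<infinity>)"
      unfolding ereal_tendsto_simps
    proof (rule Lim_null_comparison)
      show "\<forall>\<^sub>F t in at_top. norm (- exp (- w * complex_of_real t) / w) \<le> exp (- t) / norm w"
        by (intro always_eventually) (simp only: norm_minus_cancel norm_divide nrm, simp)
      have "((\<lambda>t::real. exp (- t)) \<longlongrightarrow> 0) at_top"
        by (intro filterlim_compose[OF exp_at_bot] filterlim_uminus_at_bot_at_top)
      then show "((\<lambda>t. exp (- t) / norm w) \<longlongrightarrow> 0) at_top"
        by (rule tendsto_divide_zero)
    qed
  qed simp
  finally show ?thesis by (simp add: w_def)
qed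

text \<open>
  On the line \<open>Im z = 1\<close> the hypothesis computes the characteristic function of the measure with
  density \<open>exp (- x) (c * \<alpha>) x\<close>: it is \<open>1 / (1 - \<i> x)\<close>, the one of the exponential distribution. By
  uniqueness of characteristic functions the two measures agree, hence so do their densities.
\<close>

lemma laplace_convolution_eq_1:
  assumes "laplace_measure \<nu>" "laplace_measure \<mu>"
    and eq: "\<And>z. Im z > 0 \<Longrightarrow> - \<i> * z * (LBINT t:{0<..}. exp (\<i> * z * of_real t) * complex_of_real (MA_coeff \<nu> t))
               * (LBINT t:{0<..}. exp (\<i> * z * of_real t) * complex_of_real (MA_coeff \<mu> t)) = 1"
  shows "AE x in lborel. conv (\<lambda>t. ennreal (MA_coeff \<nu> t)) (\<lambda>t. ennreal (MA_coeff \<mu> t)) x = indicator {0<..} x"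
proof -
  interpret nu: laplace_measure \<nu> by fact
  interpret mu: laplace_measure \<mu> by fact
  let ?p = "\<lambda>t. ennreal (exp (- t) * MA_coeff \<nu> t)" and ?q = "\<lambda>t. ennreal (exp (- t) * MA_coeff \<mu> t)"
  let ?C = "\<lambda>t. ennreal (MA_coeff \<nu> t)" and ?A = "\<lambda>t. ennreal (MA_coeff \<mu> t)"
  let ?e = "\<lambda>t. ennreal (exp (- t) * indicator {0<..} t)"
  have fin: "finite_measure (density lborel ?p)" "finite_measure (density lborel ?q)"
    using nu.nn_integral_exp_MA_coeff mu.nn_integral_exp_MA_coeff nu.MA_coeff_nonneg mu.MA_coeff_nonneg
    by (auto intro!: finite_measureI simp: emeasure_density ennreal_mult)
  define m where "m = (density lborel ?p \<star> density lborel ?q)"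
  have m_eq: "m = density lborel (conv ?q ?p)"
    unfolding m_def conv_def by (subst convolution_density) (use fin in \<open>auto simp: mult.commute\<close>)
  have char_m: "char m x = 1 / (1 - \<i> * x)" for x
  proof -
    have "- \<i> * Complex x 1 * char m x = 1"
      unfolding m_def char_convolution[OF fin(1) _ fin(2), simplified]
      using eq[of "Complex x 1"]
      by (simp add: char_exp_density nu.MA_coeff_nonneg mu.MA_coeff_nonneg nu.MA_coeff_nonpos mu.MA_coeff_nonpos mult.assoc)
    moreover have "- \<i> * Complex x 1 = 1 - \<i> * x" by (simp add: complex_eq_iff)
    ultimately have *: "(1 - \<i> * x) * char m x = 1" by metis
    then have "1 - \<i> * x \<noteq> 0" by auto
    with * show ?thesis by (simp add: field_simps)
  qed
  interpret m: finite_measure m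
    unfolding m_def by (intro convolution_finite fin) auto
  \<comment> \<open>The value of the characteristic function at \<open>0\<close> shows that \<open>m\<close> is a probability measure.\<close>
  have "complex_of_real (measure m (space m)) = char m 0" by (simp add: char_def scaleR_conv_of_real)
  then have "complex_of_real (measure m (space m)) = complex_of_real 1" by (simp add: char_m)
  then have "measure m (space m) = 1" by (simp only: of_real_eq_iff)
  then have "prob_space m" by (intro prob_spaceI) (simp add: m.emeasure_eq_measure)
  then have rm: "real_distribution m"
    by (auto simp: real_distribution_def real_distribution_axioms_def m_def)
  have re: "real_distribution (density lborel ?e)"
  proof -
    have "emeasure (density lborel ?e) UNIV = 1"
      using nn_integral_exp_pos[of 1] by (simp add: emeasure_density ennreal_mult ennreal_indicator)
    then have "prob_space (density lborel ?e)" by (intro prob_spaceI) simp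
    then show ?thesis by (auto simp: real_distribution_def real_distribution_axioms_def)
  qed
  have "m = density lborel ?e"
    by (rule Levy_uniqueness[OF rm re]) (simp add: fun_eq_iff char_m char_exponential)
  then have "AE x in lborel. conv ?q ?p x = ?e x"
    unfolding m_eq by (intro sigma_finite_measure.density_unique[OF lborel.sigma_finite_measure_axioms]) auto
  then show ?thesis
  proof eventually_elim
    case (elim x)
    have "conv ?p ?q x = ennreal (exp (- x)) * conv ?C ?A x"
    proof -
      have "ennreal (exp (- u) * MA_coeff \<nu> u) * ennreal (exp (- (x - u)) * MA_coeff \<mu> (x - u))
        = ennreal (exp (- x)) * (?C u * ?A (x - u))" for u
      proof -
        have "exp (- x) = exp (- u) * exp (- (x - u))" by (simp flip: exp_add)
        then show ?thesis
          by (simp add: nu.MA_coeff_nonneg mu.MA_coeff_nonneg ennreal_mult' mult_ac)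
      qed
      then show ?thesis unfolding conv_def by (simp add: nn_integral_cmult)
    qed
    then have "ennreal (exp (- x)) * conv ?C ?A x = ennreal (exp (- x)) * indicator {0<..} x"
      using elim by (simp add: conv_commute[of ?q] ennreal_mult ennreal_indicator)
    then show ?case by (simp add: ennreal_mult_cancel_left)
  qed
qed

section \<open>The integrated kernel\<close>

lemma pred_mem_lessThan [measurable (raw)]:
  fixes f g :: "'a \<Rightarrow> real"
  assumes [measurable]: "f \<in> borel_measurable M" "g \<in> borel_measurable M"
  shows "Measurable.pred M (\<lambda>x. f x \<in> {..<g x})"
  unfolding lessThan_iff by measurable

lemma pred_mem_greaterThanLessThan [measurable (raw)]:
  fixes f g k :: "'a \<Rightarrow> real"
  assumes [measurable]: "f \<in> borel_measurable M" "g \<in> borel_measurable M" "k \<in> borel_measurable M"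
  shows "Measurable.pred M (\<lambda>x. f x \<in> {g x<..<k x})"
  unfolding greaterThanLessThan_iff by measurable

text \<open>
  In this setting \<open>L\<close> is the time from the end of the observations to the prediction.
\<close>

locale convolution_unit_pair = nu: laplace_measure \<nu> + mu: laplace_measure \<mu> for \<nu> \<mu> +
  fixes L :: real
  assumes conv_eq_1: "AE x in lborel. conv (\<lambda>t. ennreal (MA_coeff \<nu> t)) (\<lambda>t. ennreal (MA_coeff \<mu> t)) x = indicator {0<..} x"
    and L_pos: "0 < L"
begin

abbreviation "c \<equiv> MA_coeff \<nu>"
abbreviation "g \<equiv> MA_primitive \<nu>"
abbreviation "\<alpha> \<equiv> MA_coeff \<mu>"
abbreviation "C \<equiv> \<lambda>t. ennreal (c t)"
abbreviation "A \<equiv> \<lambda>t. ennreal (\<alpha> t)"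
abbreviation "a \<equiv> mu.neg_deriv"

definition integrated_b :: "real \<Rightarrow> real" where
  "integrated_b r = (LBINT \<tau>:{0<..<L}. kernel_b \<nu> \<mu> r \<tau>)"

text \<open>
  The extended nonnegative version of \<open>integrated_b\<close>, cut off to \<open>0\<close> on the nonpositive numbers so
  that it can be convolved.
\<close>

definition integrated_b_ext :: "real \<Rightarrow> ennreal" where
  "integrated_b_ext r = indicator {0<..} r * (\<integral>\<^sup>+\<tau>. indicator {0<..<L} \<tau> * (\<integral>\<^sup>+u. C u * ennreal (a (r + \<tau> - u)) * indicator {..<\<tau>} u \<partial>lborel) \<partial>lborel)"

lemma integrated_b_ext_measurable [measurable]: "integrated_b_ext \<in> borel_measurable borel"
  unfolding integrated_b_ext_def by measurable

lemma kernel_b_nn: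
  assumes r: "0 < r" and \<tau>: "0 < \<tau>"
  shows "ennreal (kernel_b \<nu> \<mu> r \<tau>) = (\<integral>\<^sup>+u. C u * ennreal (a (r + \<tau> - u)) * indicator {..<\<tau>} u \<partial>lborel)"
    and "0 \<le> kernel_b \<nu> \<mu> r \<tau>"
    and "kernel_b \<nu> \<mu> r \<tau> \<le> a r * g \<tau>"
proof -
  let ?f = "\<lambda>u. indicator {..<\<tau>} u * (c u * a (r + \<tau> - u))"
  have k: "kernel_b \<nu> \<mu> r \<tau> = (LBINT u. ?f u)"
    unfolding kernel_b_def set_lebesgue_integral_def
    using r \<tau> by (intro Bochner_Integration.integral_cong) (auto simp: indicator_def mu.AR_coeff_eq nu.MA_coeff_nonpos)
  have nn: "0 \<le> ?f u" for u by (simp add: nu.MA_coeff_nonneg mu.neg_deriv_nonneg)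
  have le: "?f u \<le> a r * (indicator {..<\<tau>} u * c u)" for u
    using mu.neg_deriv_antimono[of r "r + \<tau> - u"] r nu.MA_coeff_nonneg[of u]
    by (auto simp: indicator_def mult.commute intro: mult_left_mono)
  have i2: "integrable lborel (\<lambda>u. a r * (indicator {..<\<tau>} u * c u))"
    by (intro integrable_mult_right nu.integrable_MA_coeff)
  have i: "integrable lborel ?f"
    by (rule Bochner_Integration.integrable_bound[OF i2])
       (use nn le in \<open>auto intro!: AE_I2 simp: abs_of_nonneg order_trans[OF nn le]\<close>)
  show "0 \<le> kernel_b \<nu> \<mu> r \<tau>" unfolding k by (intro integral_nonneg_AE AE_I2 nn)
  have "kernel_b \<nu> \<mu> r \<tau> \<le> (LBINT u. a r * (indicator {..<\<tau>} u * c u))"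
    unfolding k by (intro integral_mono i i2 le)
  also have "\<dots> = a r * g \<tau>" by (simp add: nu.MA_primitive_eq)
  finally show "kernel_b \<nu> \<mu> r \<tau> \<le> a r * g \<tau>" .
  show "ennreal (kernel_b \<nu> \<mu> r \<tau>) = (\<integral>\<^sup>+u. C u * ennreal (a (r + \<tau> - u)) * indicator {..<\<tau>} u \<partial>lborel)"
    unfolding k using nn
    by (subst nn_integral_eq_integral[OF i, symmetric])
       (auto intro!: nn_integral_cong simp: indicator_def ennreal_mult nu.MA_coeff_nonneg mu.neg_deriv_nonneg)
qed

lemma ennreal_integrated_b:
  assumes r: "0 < r"
  shows "ennreal (integrated_b r) = integrated_b_ext r" "0 \<le> integrated_b r"
proof -
  let ?K = "\<lambda>\<tau>. indicator {0<..<L} \<tau> * (\<integral>\<^sup>+u. C u * ennreal (a (r + \<tau> - u)) * indicator {..<\<tau>} u \<partial>lborel)"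
  let ?f = "\<lambda>\<tau>. indicator {0<..<L} \<tau> * kernel_b \<nu> \<mu> r \<tau>"
  have K: "?K \<tau> = ennreal (?f \<tau>)" for \<tau>
    using kernel_b_nn[OF r, of \<tau>] by (auto simp: indicator_def)
  have f_eq: "?f \<tau> = enn2real (?K \<tau>)" for \<tau>
    unfolding K using kernel_b_nn(2)[OF r, of \<tau>] by (auto simp: indicator_def)
  have m: "?f \<in> borel_measurable lborel" unfolding f_eq by measurable
  have nn: "0 \<le> ?f \<tau>" for \<tau> using kernel_b_nn(2)[OF r, of \<tau>] by (auto simp: indicator_def)
  have le: "?f \<tau> \<le> indicator {0<..<L} \<tau> * (a r * g L)" for \<tau>
  proof (cases "\<tau> \<in> {0<..<L}")
    case True
    then have "kernel_b \<nu> \<mu> r \<tau> \<le> a r * g \<tau>" using r by (intro kernel_b_nn) auto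
    also have "\<dots> \<le> a r * g L"
      using True by (intro mult_left_mono nu.MA_primitive_mono mu.neg_deriv_nonneg) auto
    finally show ?thesis using True by simp
  qed simp
  have i: "integrable lborel ?f"
  proof (rule Bochner_Integration.integrable_bound[OF _ m])
    show "integrable lborel (\<lambda>\<tau>. indicator {0<..<L} \<tau> * (a r * g L))"
      using L_pos by (intro integrable_mult_left integrable_real_indicator) auto
    show "AE \<tau> in lborel. norm (?f \<tau>) \<le> norm (indicator {0<..<L} \<tau> * (a r * g L))"
      using nn le by (intro AE_I2) (simp add: order_trans[OF nn le])
  qed
  have integrated_b: "integrated_b r = (LBINT \<tau>. ?f \<tau>)" by (simp add: integrated_b_def set_lebesgue_integral_def)
  show "0 \<le> integrated_b r" unfolding integrated_b by (intro integral_nonneg_AE AE_I2 nn)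
  show "ennreal (integrated_b r) = integrated_b_ext r"
    unfolding integrated_b integrated_b_ext_def using r nn_integral_eq_integral[OF i] nn by (simp add: K)
qed

text \<open>
  The kernel \<open>b\<close> is decreasing in its first argument because \<open>- \<alpha>'\<close> is, \<open>\<alpha>\<close> being convex.
\<close>

lemma integrated_b_antimono:
  assumes "0 < r" "r \<le> r'"
  shows "integrated_b r' \<le> integrated_b r"
proof -
  have "integrated_b_ext r' \<le> integrated_b_ext r"
  proof -
    have "C u * ennreal (a (r' + \<tau> - u)) * indicator {..<\<tau>} u \<le> C u * ennreal (a (r + \<tau> - u)) * indicator {..<\<tau>} u" for u \<tau>
      using assms by (cases "u < \<tau>") (auto intro!: mult_left_mono ennreal_leI mu.neg_deriv_antimono)
    then show ?thesis
      unfolding integrated_b_ext_def using assms by (auto intro!: mult_left_mono nn_integral_mono)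
  qed
  then have "ennreal (integrated_b r') \<le> ennreal (integrated_b r)"
    using assms ennreal_integrated_b(1)[of r] ennreal_integrated_b(1)[of r'] by simp
  then show ?thesis using assms ennreal_integrated_b(2)[of r] by simp
qed

lemma integrated_b_measurable: "(\<lambda>r. indicator {0<..} r * integrated_b r) \<in> borel_measurable borel"
proof -
  have "indicator {0<..} r * integrated_b r = enn2real (integrated_b_ext r)" for r
  proof (cases "0 < r")
    case True
    then show ?thesis using ennreal_integrated_b(2)[OF True] by (simp flip: ennreal_integrated_b(1))
  qed (simp add: integrated_b_ext_def)
  then show ?thesis by simp
qed

text \<open>
  The fundamental theorem of calculus for \<open>- \<alpha>\<close>, with the subtraction moved to the other side.
\<close>

lemma alpha_increment:
  assumes r: "0 < r" and u: "u < L"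
  shows "(\<integral>\<^sup>+\<tau>. ennreal (a (r + \<tau> - u)) * indicator {u<..<L} \<tau> \<partial>lborel) + A (r + L - u) = A r"
proof -
  have "(\<integral>\<^sup>+\<tau>. ennreal (a (r + \<tau> - u)) * indicator {u<..<L} \<tau> \<partial>lborel)
      = (\<integral>\<^sup>+\<tau>. ennreal (a (r + \<tau> - u)) * indicator {u..L} \<tau> \<partial>lborel)"
    using AE_lborel_singleton[of u] AE_lborel_singleton[of L]
    by (intro nn_integral_cong_AE) (auto simp: indicator_def)
  also have "\<dots> = ennreal (- \<alpha> (r + L - u) - - \<alpha> (r + u - u))"
  proof (rule nn_integral_FTC_Icc)
    fix \<tau> assume "\<tau> \<in> {u..L}"
    then have "(\<alpha> has_real_derivative - a (r + \<tau> - u)) (at (r + \<tau> - u))"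
      using r by (intro mu.MA_coeff_has_derivative) auto
    then show "((\<lambda>\<tau>. - \<alpha> (r + \<tau> - u)) has_real_derivative a (r + \<tau> - u)) (at \<tau>)"
      by (auto intro!: derivative_eq_intros DERIV_chain'[of "\<lambda>\<tau>. r + \<tau> - u" 1 \<tau>])
  qed (use u in \<open>auto simp: mu.neg_deriv_nonneg\<close>)
  finally show ?thesis
    using r u mu.MA_coeff_antimono[of r "r + L - u"] mu.MA_coeff_nonneg by (simp flip: ennreal_plus)
qed

text \<open>
  The part of the convolution of \<open>c\<close> and \<open>\<alpha>\<close> at \<open>r + L\<close> in which \<open>c\<close> has an argument below \<open>L\<close>. The
  other part is \<open>conv shifted_c A r\<close>.
\<close>

definition conv_head :: "real \<Rightarrow> ennreal" where
  "conv_head r = (\<integral>\<^sup>+u. C u * A (r + L - u) * indicator {..<L} u \<partial>lborel)"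

definition shifted_c :: "real \<Rightarrow> ennreal" where
  "shifted_c v = C (L + v) * indicator {0<..} v"

lemma shifted_c_measurable [measurable]: "shifted_c \<in> borel_measurable borel"
  unfolding shifted_c_def by measurable

text \<open>
  After exchanging the integrations over \<open>\<tau>\<close> and \<open>u\<close>, the inner integral of \<open>- \<alpha>'\<close> is an increment
  of \<open>\<alpha>\<close>.
\<close>

lemma integrated_b_plus_conv_head:
  assumes r: "0 < r"
  shows "integrated_b_ext r + conv_head r = ennreal (g L) * A r"
proof -
  have "integrated_b_ext r = (\<integral>\<^sup>+\<tau>. \<integral>\<^sup>+u. indicator {0<..<L} \<tau> * (C u * ennreal (a (r + \<tau> - u)) * indicator {..<\<tau>} u) \<partial>lborel \<partial>lborel)"
    unfolding integrated_b_ext_def using r by (simp add: nn_integral_cmult)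
  also have "\<dots> = (\<integral>\<^sup>+u. \<integral>\<^sup>+\<tau>. indicator {0<..<L} \<tau> * (C u * ennreal (a (r + \<tau> - u)) * indicator {..<\<tau>} u) \<partial>lborel \<partial>lborel)"
    by (rule lborel_pair.Fubini') measurable
  also have "\<dots> = (\<integral>\<^sup>+u. \<integral>\<^sup>+\<tau>. (C u * indicator {..<L} u) * (ennreal (a (r + \<tau> - u)) * indicator {u<..<L} \<tau>) \<partial>lborel \<partial>lborel)"
    by (intro nn_integral_cong) (auto simp: indicator_def nu.MA_coeff_nonpos)
  also have "\<dots> = (\<integral>\<^sup>+u. (C u * indicator {..<L} u) * (\<integral>\<^sup>+\<tau>. ennreal (a (r + \<tau> - u)) * indicator {u<..<L} \<tau> \<partial>lborel) \<partial>lborel)"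
    by (simp add: nn_integral_cmult)
  finally have integrated_b_ext: "integrated_b_ext r = (\<integral>\<^sup>+u. (C u * indicator {..<L} u) * (\<integral>\<^sup>+\<tau>. ennreal (a (r + \<tau> - u)) * indicator {u<..<L} \<tau> \<partial>lborel) \<partial>lborel)" .
  have "integrated_b_ext r + conv_head r = (\<integral>\<^sup>+u. (C u * indicator {..<L} u) * (\<integral>\<^sup>+\<tau>. ennreal (a (r + \<tau> - u)) * indicator {u<..<L} \<tau> \<partial>lborel)
      + C u * A (r + L - u) * indicator {..<L} u \<partial>lborel)"
    unfolding integrated_b_ext conv_head_def by (rule nn_integral_add[symmetric]) measurable
  also have "\<dots> = (\<integral>\<^sup>+u. (C u * indicator {..<L} u) * A r \<partial>lborel)"
  proof (rule nn_integral_cong)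
    fix u
    show "(C u * indicator {..<L} u) * (\<integral>\<^sup>+\<tau>. ennreal (a (r + \<tau> - u)) * indicator {u<..<L} \<tau> \<partial>lborel)
      + C u * A (r + L - u) * indicator {..<L} u = (C u * indicator {..<L} u) * A r"
      using alpha_increment[OF r, of u]
      by (cases "u < L") (auto simp flip: distrib_left)
  qed
  also have "\<dots> = ennreal (g L) * A r"
    unfolding nu.MA_primitive_nn by (rule nn_integral_multc) measurable
  finally show ?thesis .
qed

lemma conv_head_plus_tail:
  assumes r: "0 < r"
  shows "conv_head r + conv shifted_c A r = conv C A (r + L)"
proof -
  have "conv shifted_c A r = (\<integral>\<^sup>+v. (C (L + v) * indicator {L<..} (L + v)) * A (r + L - (L + v)) \<partial>lborel)"
    unfolding conv_def shifted_c_def by (intro nn_integral_cong) (auto simp: indicator_def)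
  also have "\<dots> = (\<integral>\<^sup>+u. (C u * indicator {L<..} u) * A (r + L - u) \<partial>lborel)"
    by (rule nn_integral_shift) measurable
  finally have "conv_head r + conv shifted_c A r = (\<integral>\<^sup>+u. C u * A (r + L - u) * indicator {..<L} u + (C u * indicator {L<..} u) * A (r + L - u) \<partial>lborel)"
    unfolding conv_head_def by (simp add: nn_integral_add)
  also have "\<dots> = conv C A (r + L)"
    unfolding conv_def using AE_lborel_singleton[of L]
    by (intro nn_integral_cong_AE) (auto simp: indicator_def)
  finally show ?thesis .
qed

text \<open>
  Adding the tail of the convolution to both sides of \<open>integrated_b_plus_conv_head\<close> completes the
  head to \<open>c * \<alpha>\<close>, that is, to \<open>1\<close>.
\<close>

lemma integrated_b_decomposition:
  "AE r in lborel. integrated_b_ext r + indicator {0<..} r = ennreal (g L) * A r + conv shifted_c A r"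
proof -
  have "AE r in lborel. conv C A (L + 1 * r) = indicator {0<..} (L + 1 * r)"
    by (rule AE_borel_affine[OF _ _ conv_eq_1]) auto
  then show ?thesis
  proof eventually_elim
    case (elim r)
    show ?case
    proof (cases "0 < r")
      case True
      have "integrated_b_ext r + indicator {0<..} r = integrated_b_ext r + conv C A (r + L)"
        using elim True L_pos by (simp add: add.commute)
      also have "\<dots> = (integrated_b_ext r + conv_head r) + conv shifted_c A r"
        by (simp add: conv_head_plus_tail[OF True, symmetric] add.assoc)
      finally show ?thesis by (simp add: integrated_b_plus_conv_head[OF True])
    next
      case False
      have "conv shifted_c A r = (\<integral>\<^sup>+(v::real). 0 \<partial>lborel)"
        unfolding conv_def shifted_c_def using False
        by (intro nn_integral_cong) (auto simp: indicator_def mu.MA_coeff_nonpos)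
      then show ?thesis using False by (simp add: integrated_b_ext_def mu.MA_coeff_nonpos)
    qed
  qed
qed

lemma conv_step_left:
  "conv (indicator {0<..}) C x = ennreal (g x)"
proof -
  have "conv (indicator {0<..}) C x = conv C (indicator {0<..}) x"
    by (rule conv_commute) measurable
  also have "\<dots> = ennreal (g x)"
    unfolding conv_def nu.MA_primitive_nn
    by (intro nn_integral_cong) (auto simp: indicator_def)
  finally show ?thesis .
qed

lemma primitive_plus_tail:
  assumes x: "0 < x"
  shows "ennreal (g L) + conv shifted_c (indicator {0<..}) x = ennreal (g (x + L))"
proof -
  have "conv shifted_c (indicator {0<..}) x = (\<integral>\<^sup>+v. C (L + v) * indicator {L<..<x + L} (L + v) \<partial>lborel)"
    unfolding conv_def shifted_c_def by (intro nn_integral_cong) (auto simp: indicator_def)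
  also have "\<dots> = (\<integral>\<^sup>+u. C u * indicator {L<..<x + L} u \<partial>lborel)"
    by (rule nn_integral_shift) measurable
  finally have "ennreal (g L) + conv shifted_c (indicator {0<..}) x
      = (\<integral>\<^sup>+u. C u * indicator {..<L} u + C u * indicator {L<..<x + L} u \<partial>lborel)"
    unfolding nu.MA_primitive_nn by (simp add: nn_integral_add)
  also have "\<dots> = ennreal (g (x + L))"
    unfolding nu.MA_primitive_nn using x AE_lborel_singleton[of L]
    by (intro nn_integral_cong_AE) (auto simp: indicator_def)
  finally show ?thesis .
qed

text \<open>
  Convolve the decomposition with \<open>c\<close>. On the left \<open>1 * c = g\<close>; on the right \<open>\<alpha> * c = 1\<close> removes
  \<open>\<alpha>\<close> from both terms, and what is left is the integral of \<open>c\<close> up to \<open>x + L\<close>.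
\<close>

lemma conv_integrated_b_c:
  "AE x in lborel. 0 < x \<longrightarrow> conv integrated_b_ext C x = ennreal (g (x + L) - g x)"
  using conv_eq_1
proof eventually_elim
  case (elim x)
  show ?case
  proof
    assume x: "0 < x"
    let ?E = "indicator {0<..} :: real \<Rightarrow> ennreal"
    have [measurable]: "C \<in> borel_measurable borel" "A \<in> borel_measurable borel" by measurable
    have "conv integrated_b_ext C x + ennreal (g x) = conv (\<lambda>r. integrated_b_ext r + ?E r) C x"
      by (simp add: conv_add_left conv_step_left)
    also have "\<dots> = conv (\<lambda>r. ennreal (g L) * A r + conv shifted_c A r) C x"
      by (rule conv_cong_AE_left[OF integrated_b_decomposition])
    also have "\<dots> = ennreal (g L) * conv A C x + conv (conv shifted_c A) C x"
      by (simp add: conv_add_left conv_cmult_left)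
    also have "conv A C x = 1"
      using elim x by (simp add: conv_commute[of A C])
    also have "conv (conv shifted_c A) C x = conv shifted_c (conv A C) x"
      by (rule conv_assoc) measurable
    also have "conv shifted_c (conv A C) x = conv shifted_c ?E x"
    proof (rule conv_cong_AE_right)
      show "AE u in lborel. conv A C u = ?E u"
        using conv_eq_1 by (simp add: conv_commute[of A C])
    qed measurable
    also have "ennreal (g L) * 1 + conv shifted_c ?E x = ennreal (g (x + L))"
      using primitive_plus_tail[OF x] by simp
    also have "\<dots> = ennreal (g (x + L) - g x) + ennreal (g x)"
      using nu.MA_primitive_mono[of x "x + L"] nu.MA_primitive_nonneg[of x] L_pos
      by (simp flip: ennreal_plus)
    finally show "conv integrated_b_ext C x = ennreal (g (x + L) - g x)"
      by (simp add: add.commute[of _ "ennreal (g x)"] ennreal_add_left_cancel)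
  qed
qed

end

section \<open>Integration with respect to a moving average process\<close>

lemma lin_span_base: "t \<in> I \<Longrightarrow> X t \<in> lin_span X I"
  unfolding lin_span_def by (auto intro!: exI[of _ "{t}"] exI[of _ "\<lambda>_. 1"])

lemma lin_span_zero: "(\<lambda>_. 0) \<in> lin_span X I"
  unfolding lin_span_def by (auto intro!: exI[of _ "{}"])

lemma lin_span_add_scaled:
  assumes "Y \<in> lin_span X I" "Z \<in> lin_span X I"
  shows "(\<lambda>\<omega>. Y \<omega> + d * Z \<omega>) \<in> lin_span X I"
proof -
  obtain S a where S: "finite S" "S \<subseteq> I" "Y = (\<lambda>\<omega>. \<Sum>t\<in>S. a t * X t \<omega>)"
    using assms(1) by (auto simp: lin_span_def)
  obtain S' a' where S': "finite S'" "S' \<subseteq> I" "Z = (\<lambda>\<omega>. \<Sum>t\<in>S'. a' t * X t \<omega>)"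
    using assms(2) by (auto simp: lin_span_def)
  define e where "e t = (if t \<in> S then a t else 0) + d * (if t \<in> S' then a' t else 0)" for t
  have "Y \<omega> + d * Z \<omega> = (\<Sum>t\<in>S \<union> S'. e t * X t \<omega>)" for \<omega>
  proof -
    have "Y \<omega> = (\<Sum>t\<in>S \<union> S'. (if t \<in> S then a t else 0) * X t \<omega>)"
      unfolding S(3) using S(1) S'(1) by (intro sum.mono_neutral_cong_left) auto
    moreover have "Z \<omega> = (\<Sum>t\<in>S \<union> S'. (if t \<in> S' then a' t else 0) * X t \<omega>)"
      unfolding S'(3) using S(1) S'(1) by (intro sum.mono_neutral_cong_left) auto
    ultimately show ?thesis
      by (simp add: e_def distrib_right sum.distrib sum_distrib_left mult.assoc)
  qed
  then show ?thesis
    unfolding lin_span_def using S S' by (auto intro!: exI[of _ "S \<union> S'"] exI[of _ e])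
qed

lemma closed_span_add_scaled:
  assumes "Y \<in> closed_span M X I" "Z \<in> closed_span M X I"
  shows "(\<lambda>\<omega>. Y \<omega> + d * Z \<omega>) \<in> closed_span M X I"
proof -
  obtain F where F: "\<And>n. F n \<in> lin_span X I" "L2_lim M F Y"
    using assms(1) by (auto simp: closed_span_def)
  obtain G where G: "\<And>n. G n \<in> lin_span X I" "L2_lim M G Z"
    using assms(2) by (auto simp: closed_span_def)
  have "L2_lim M (\<lambda>n \<omega>. F n \<omega> + d * G n \<omega>) (\<lambda>\<omega>. Y \<omega> + d * Z \<omega>)"
    by (rule L2_lim_add_scaled[OF F(2) G(2)])
  moreover have "(\<lambda>\<omega>. F n \<omega> + d * G n \<omega>) \<in> lin_span X I" for n
    by (rule lin_span_add_scaled[OF F(1) G(1)])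
  ultimately show ?thesis unfolding closed_span_def by (auto intro!: exI[of _ "\<lambda>n \<omega>. F n \<omega> + d * G n \<omega>"])
qed

lemma closed_span_base:
  assumes "t \<in> I" "X t \<in> L2_functions M"
  shows "X t \<in> closed_span M X I"
  unfolding closed_span_def using lin_span_base[of t I X] assms L2_lim_const[of "X t" M]
  by (auto intro!: exI[of _ "\<lambda>_. X t"])

lemma grid_mono:
  fixes t :: "nat \<Rightarrow> real"
  assumes "\<forall>k<m. t k < t (Suc k)" "i \<le> j" "j \<le> m"
  shows "t i \<le> t j"
  using assms(2,3)
proof (induction j)
  case (Suc j)
  show ?case
  proof (cases "i = Suc j")
    case False
    then have "t i \<le> t j" using Suc by auto
    also have "t j < t (Suc j)" using assms(1) Suc by auto
    finally show ?thesis by simp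
  qed simp
qed simp

lemma simple_integral_support:
  assumes "has_simple_integral X I \<phi> Z" "x \<notin> I"
  shows "\<phi> x = 0"
proof -
  obtain m t a where t: "\<forall>k<m. t k < t (Suc k)" "{t 0<..t m} \<subseteq> I"
      and \<phi>: "\<phi> = (\<lambda>x. \<Sum>k<m. a k * indicator {t k<..t (Suc k)} x)"
    using assms(1) unfolding has_simple_integral_def by (elim exE conjE) (rule that)
  have "{t k<..t (Suc k)} \<subseteq> I" if "k < m" for k
    using grid_mono[OF t(1), of 0 k] grid_mono[OF t(1), of "Suc k" m] t(2) that by fastforce
  then have "x \<notin> {t k<..t (Suc k)}" if "k < m" for k using assms(2) that by blast
  then show ?thesis unfolding \<phi> by (intro sum.neutral) (auto simp: indicator_def)
qed

lemma simple_integral_measurable: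
  assumes "has_simple_integral X I \<phi> Z"
  shows "\<phi> \<in> borel_measurable borel"
proof -
  obtain m t a where \<phi>: "\<phi> = (\<lambda>x. \<Sum>k<(m::nat). a k * indicator {t k<..t (Suc k)} x)"
    using assms(1) unfolding has_simple_integral_def by (elim exE conjE) (rule that)
  show ?thesis unfolding \<phi> by measurable
qed

text \<open>
  Closedness of \<open>I\<close> is needed for the leftmost grid point, which the half-open support omits.
\<close>

lemma simple_integral_lin_span:
  assumes "has_simple_integral X I \<phi> Z" "closed I"
  shows "Z \<in> lin_span X I"
proof -
  obtain m t a where t: "\<forall>k<m. t k < t (Suc k)" "{t 0<..t m} \<subseteq> I"
      and Z: "Z = (\<lambda>\<omega>. \<Sum>k<m. a k * (X (t (Suc k)) \<omega> - X (t k) \<omega>))"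
    using assms(1) unfolding has_simple_integral_def by (elim exE conjE) (rule that)
  have tI: "t k \<in> I" if "k \<le> m" "0 < m" for k
  proof -
    have "t 0 < t m"
      using t(1) grid_mono[OF t(1), of "Suc 0" m] that by force
    then have "closure {t 0<..t m} = {t 0..t m}" by simp
    then have "{t 0..t m} \<subseteq> I" using closure_minimal[OF t(2) assms(2)] by simp
    then show ?thesis using grid_mono[OF t(1), of 0 k] grid_mono[OF t(1), of k m] that by auto
  qed
  have "n \<le> m \<Longrightarrow> (\<lambda>\<omega>. \<Sum>k<n. a k * (X (t (Suc k)) \<omega> - X (t k) \<omega>)) \<in> lin_span X I" for n
  proof (induction n)
    case (Suc n)
    have "(\<lambda>\<omega>. ((\<Sum>k<n. a k * (X (t (Suc k)) \<omega> - X (t k) \<omega>)) + a n * X (t (Suc n)) \<omega>) + (- a n) * X (t n) \<omega>) \<in> lin_span X I"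
      using Suc tI by (intro lin_span_add_scaled lin_span_base) auto
    then show ?case by (simp add: algebra_simps)
  qed (simp add: lin_span_zero)
  then show ?thesis unfolding Z by simp
qed

text \<open>
  Step functions take on each dyadic interval the value of \<open>p\<close> at the left end. As \<open>p\<close> is
  increasing, they lie below \<open>p\<close> and increase under refinement, and they converge at every point
  of continuity, that is, off a countable set.
\<close>

lemma step_approx_exists:
  fixes p :: "real \<Rightarrow> real"
  assumes mono: "mono_on {..<b} p" and nonneg: "\<And>x. x < b \<Longrightarrow> 0 \<le> p x"
  shows "\<exists>\<phi> Z. simple_approx X {..b} p \<phi> Z"
proof -
  define t where "t n k = b - real n + real k / 2^n" for n k :: nat
  define \<phi> where "\<phi> n x = (\<Sum>k<n * 2^n. p (t n k) * indicator {t n k<..t n (Suc k)} x)" for n x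
  define Z where "Z n \<omega> = (\<Sum>k<n * 2^n. p (t n k) * (X (t n (Suc k)) \<omega> - X (t n k) \<omega>))" for n \<omega>
  \<comment> \<open>The left end of the half-open dyadic interval of length \<open>2\<^sup>-\<^sup>n\<close> that contains \<open>x\<close>.\<close>
  define lo where "lo n x = b + (of_int \<lceil>(x - b) * 2^n\<rceil> - 1) / 2^n" for n :: nat and x
  have t_m: "t n (n * 2^n) = b" "t n 0 = b - n" for n by (simp_all add: t_def)
  have simple: "has_simple_integral X {..b} (\<phi> n) (Z n)" for n
    unfolding has_simple_integral_def
    by (rule exI[of _ "n * 2^n"], rule exI[of _ "t n"], rule exI[of _ "\<lambda>k. p (t n k)"])
       (use t_m in \<open>auto simp: \<phi>_def Z_def t_def divide_strict_right_mono\<close>)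
  have lo_less: "lo n x < x" and lo_gt: "x - 1 / 2^n \<le> lo n x" for n x
  proof -
    have 1: "of_int \<lceil>(x - b) * 2^n\<rceil> - 1 < (x - b) * 2^n" "(x - b) * 2^n \<le> of_int \<lceil>(x - b) * 2^n\<rceil>"
      by linarith+
    then have "(of_int \<lceil>(x - b) * 2^n\<rceil> - 1) / 2^n < x - b" by (simp add: divide_less_eq)
    then show "lo n x < x" by (simp add: lo_def)
    have "x - b - 1 / 2^n = ((x - b) * 2^n - 1) / 2^n" by (simp add: diff_divide_distrib)
    also have "\<dots> \<le> (of_int \<lceil>(x - b) * 2^n\<rceil> - 1) / 2^n" using 1 by (intro divide_right_mono) auto
    finally show "x - 1 / 2^n \<le> lo n x" by (simp add: lo_def)
  qed
  have lo_mono: "lo n x \<le> lo (Suc n) x" for n x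
  proof -
    define i where "i = \<lceil>(x - b) * 2^n\<rceil>"
    have "of_int (2 * i - 2) < (x - b) * 2^Suc n" unfolding i_def by simp linarith
    then have "2 * i - 1 \<le> \<lceil>(x - b) * 2^Suc n\<rceil>" by linarith
    then have "real_of_int (2 * i - 1) \<le> real_of_int \<lceil>(x - b) * 2^Suc n\<rceil>" by (simp only: of_int_le_iff)
    then have "2 * (of_int i - 1) \<le> (of_int \<lceil>(x - b) * 2^Suc n\<rceil> - 1 :: real)" by simp
    then have "2 * (of_int i - 1) / 2^Suc n \<le> (of_int \<lceil>(x - b) * 2^Suc n\<rceil> - 1) / (2^Suc n :: real)"
      by (intro divide_right_mono) auto
    moreover have "2 * y / 2^Suc n = y / 2^n" for y :: real by simp
    ultimately show ?thesis unfolding lo_def i_def by (simp only: add_le_cancel_left)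
  qed
  have \<phi>_eq: "\<phi> n x = (if b - n < x then p (lo n x) else 0)" if x: "x \<le> b" for n x
  proof -
    have iff: "x \<in> {t n k<..t n (Suc k)} \<longleftrightarrow> int k = \<lceil>(x - b) * 2^n\<rceil> + int n * 2^n - 1" for k
    proof -
      have "x \<in> {t n k<..t n (Suc k)} \<longleftrightarrow> real k / 2^n < x - b + n \<and> x - b + n \<le> (1 + real k) / 2^n"
        by (auto simp: t_def)
      also have "\<dots> \<longleftrightarrow> real k < (x - b + n) * 2^n \<and> (x - b + n) * 2^n \<le> 1 + real k"
        by (simp add: pos_divide_less_eq pos_le_divide_eq)
      also have "\<dots> \<longleftrightarrow> \<lceil>(x - b) * 2^n + of_int (int n * 2^n)\<rceil> = int k + 1"
        unfolding ceiling_eq_iff by (simp add: algebra_simps)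
      also have "\<dots> \<longleftrightarrow> int k = \<lceil>(x - b) * 2^n\<rceil> + int n * 2^n - 1"
        unfolding ceiling_add_of_int by linarith
      finally show ?thesis .
    qed
    show ?thesis
    proof (cases "b - n < x")
      case True
      define j where "j = nat (\<lceil>(x - b) * 2^n\<rceil> + int n * 2^n - 1)"
      have "- (real n * 2^n) < (x - b) * 2^n"
        using True mult_strict_right_mono[of "- real n" "x - b" "2^n"] by simp
      then have "of_int (- (int n * 2^n)) < (x - b) * 2^n" by simp
      then have "- (int n * 2^n) < \<lceil>(x - b) * 2^n\<rceil>" by (simp only: less_ceiling_iff)
      then have pos: "0 \<le> \<lceil>(x - b) * 2^n\<rceil> + int n * 2^n - 1" by linarith
      have "(x - b) * 2^n \<le> 0" using x by (simp add: mult_nonpos_nonneg)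
      then have "\<lceil>(x - b) * 2^n\<rceil> \<le> 0" by linarith
      then have "int j < int (n * 2^n)" using pos by (simp add: j_def)
      then have j: "j < n * 2^n" by linarith
      have ij: "int j = \<lceil>(x - b) * 2^n\<rceil> + int n * 2^n - 1" using pos by (simp add: j_def)
      have "\<phi> n x = (\<Sum>k<n * 2^n. if k = j then p (t n k) else 0)"
        unfolding \<phi>_def using iff ij by (intro sum.cong) (auto simp: indicator_def)
      also have "\<dots> = p (t n j)" using j by simp
      also have "t n j = lo n x"
      proof -
        have "real j = of_int \<lceil>(x - b) * 2^n\<rceil> + real n * 2^n - 1"
          using arg_cong[OF ij, of real_of_int] by simp
        then show ?thesis by (simp add: t_def lo_def add_divide_distrib diff_divide_distrib)
      qed
      finally show ?thesis using True by simp
    next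
      case False
      have "b - n \<le> t n k" for k by (simp add: t_def)
      then have "x \<notin> {t n k<..t n (Suc k)}" for k
        using False by (meson greaterThanAtMost_iff le_less_trans not_less)
      then have "\<phi> n x = 0" unfolding \<phi>_def by (intro sum.neutral) auto
      then show ?thesis using False by simp
    qed
  qed
  have countable: "countable {x\<in>{..<b}. \<not> isCont p x}"
    by (rule mono_on_ctble_discont_open[OF _ mono]) simp
  have AE_cont: "AE x in lborel. x < b \<longrightarrow> isCont p x"
    by (rule AE_I'[OF countable_imp_null_set_lborel[OF countable]]) auto
  have "simple_approx X {..b} p \<phi> Z"
    unfolding simple_approx_def
  proof (intro conjI allI)
    show "has_simple_integral X {..b} (\<phi> n) (Z n)" for n by (rule simple)
    have tb: "t n k < b" if "k < n * 2^n" for n k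
    proof -
      have "real k < real n * 2^n" using of_nat_less_iff[of k "n * 2^n", where 'a=real] that by simp
      then show ?thesis by (simp add: t_def divide_less_eq)
    qed
    show "0 \<le> \<phi> n x" for n x
      unfolding \<phi>_def by (intro sum_nonneg mult_nonneg_nonneg nonneg tb) auto
    show "AE x in lborel. x \<in> {..b} \<longrightarrow> incseq (\<lambda>n. \<phi> n x) \<and> (\<lambda>n. \<phi> n x) \<longlonglongrightarrow> p x"
      using AE_cont AE_lborel_singleton[of b]
    proof eventually_elim
      case (elim x)
      show ?case
      proof (intro impI conjI)
        assume "x \<in> {..b}"
        then have x: "x < b" "x \<le> b" using elim by auto
        have lob: "lo n x < b" for n using lo_less[of n x] x by simp
        show "incseq (\<lambda>n. \<phi> n x)"
        proof (rule incseq_SucI)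
          fix n
          show "\<phi> n x \<le> \<phi> (Suc n) x"
            unfolding \<phi>_eq[OF x(2)]
            using mono_onD[OF mono _ _ lo_mono[of n x]] lob nonneg[OF lob[of "Suc n"]] by auto
        qed
        have "(\<lambda>n. lo n x) \<longlonglongrightarrow> x"
        proof (rule tendsto_sandwich[OF _ _ _ tendsto_const])
          have "(\<lambda>n. x - (1/2)^n) \<longlonglongrightarrow> x - 0"
            by (intro tendsto_intros LIMSEQ_power_zero) auto
          then show "(\<lambda>n. x - 1 / 2^n) \<longlonglongrightarrow> x" by (simp add: power_one_over)
        qed (auto intro!: always_eventually lo_gt less_imp_le[OF lo_less])
        then have "(\<lambda>n. p (lo n x)) \<longlonglongrightarrow> p x"
          using elim x by (intro isCont_tendsto_compose[of x p]) auto
        moreover have "\<forall>\<^sub>F n in sequentially. p (lo n x) = \<phi> n x"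
        proof -
          obtain K :: nat where "b - x < K" using reals_Archimedean2 by blast
          then have "b - real n < x" if "n \<ge> K" for n
            using of_nat_mono[OF that, where 'a=real] by linarith
          then show ?thesis
            unfolding eventually_sequentially \<phi>_eq[OF x(2)] by (intro exI[of _ K]) auto
        qed
        ultimately show "(\<lambda>n. \<phi> n x) \<longlonglongrightarrow> p x" by (rule Lim_transform_eventually)
      qed
    qed
  qed
  then show ?thesis by blast
qed

lemma H_space_pos_neg_parts:
  assumes "f \<in> H_space c I"
  shows "(\<lambda>x. max (f x) 0) \<in> H_space c I" "(\<lambda>x. max (- f x) 0) \<in> H_space c I"
proof -
  have m: "(\<lambda>x. indicator I x * f x) \<in> borel_measurable borel"
    and fin: "(\<integral>\<^sup>+s. (\<integral>\<^sup>+u\<in>I. ennreal (\<bar>f u\<bar> * c (u - s)) \<partial>lborel)\<^sup>2 \<partial>lborel) < \<infinity>"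
    using assms by (auto simp: H_space_def set_borel_measurable_def)
  have *: "q \<in> H_space c I"
    if "\<And>x. 0 \<le> q x" "\<And>x. q x \<le> \<bar>f x\<bar>" "(\<lambda>x. indicator I x * q x) \<in> borel_measurable borel" for q
  proof -
    have le: "ennreal (\<bar>q u\<bar> * c (u - s)) * indicator I u \<le> ennreal (\<bar>f u\<bar> * c (u - s)) * indicator I u" for u s
    proof (cases "0 \<le> c (u - s)")
      case True
      then show ?thesis using that(1,2)[of u] by (intro mult_right_mono ennreal_leI) auto
    next
      case False
      then have "\<bar>q u\<bar> * c (u - s) \<le> 0" by (simp add: mult_nonneg_nonpos)
      then show ?thesis by (simp add: ennreal_neg)
    qed
    have "(\<integral>\<^sup>+s. (\<integral>\<^sup>+u\<in>I. ennreal (\<bar>q u\<bar> * c (u - s)) \<partial>lborel)\<^sup>2 \<partial>lborel)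
        \<le> (\<integral>\<^sup>+s. (\<integral>\<^sup>+u\<in>I. ennreal (\<bar>f u\<bar> * c (u - s)) \<partial>lborel)\<^sup>2 \<partial>lborel)"
      by (intro nn_integral_mono power_mono le) auto
    with fin that(3) show ?thesis by (auto simp: H_space_def set_borel_measurable_def)
  qed
  have eq: "indicator I x * max (f x) 0 = max (indicator I x * f x) 0"
    "indicator I x * max (- f x) 0 = max (- (indicator I x * f x)) 0" for x
    by (auto simp: indicator_def)
  show "(\<lambda>x. max (f x) 0) \<in> H_space c I" "(\<lambda>x. max (- f x) 0) \<in> H_space c I"
    using m by (intro *; simp add: eq)+
qed

text \<open>
  The process \<open>X\<close> as a moving average of the increments of \<open>W\<close> with the weight \<open>MA_primitive\<close>.
\<close>

locale moving_average = laplace_measure \<nu> for \<nu> :: "real measure" +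
  fixes M :: "'w measure" and W X :: "real \<Rightarrow> 'w \<Rightarrow> real"
  assumes W: "brownian_motion M W"
    and X: "\<And>t. has_wiener_integral M W (\<lambda>s. MA_primitive \<nu> (t - s) - MA_primitive \<nu> (- s)) (X t)"
begin

abbreviation has_kernel :: "('w \<Rightarrow> real) \<Rightarrow> (real \<Rightarrow> real) \<Rightarrow> bool" where
  "has_kernel \<equiv> isometric_closure M lborel (wiener_pair W)"

sublocale inner_product_preserving M lborel "wiener_pair W"
  by unfold_locales (fact wiener_pair_L2[OF W] wiener_pair_inner[OF W])+

lemma X_has_kernel: "has_kernel (X t) (\<lambda>s. MA_primitive \<nu> (t - s) - MA_primitive \<nu> (- s))"
  by (rule wiener_integral_isometric_closure[OF X])

lemma X_L2: "X t \<in> L2_functions M"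
  using isometric_closure_L2[OF X_has_kernel] by simp

text \<open>
  Formally \<open>dX u\<close> is the integral of \<open>c (u - s)\<close> with respect to \<open>dW s\<close>, times \<open>du\<close>; exchanging the
  integrations in the integral of \<open>\<phi>\<close> with respect to \<open>X\<close> leaves this function of \<open>s\<close> as integrand
  against the noise \<open>dW s\<close>.
\<close>

definition noise_kernel :: "(real \<Rightarrow> real) \<Rightarrow> real \<Rightarrow> real" where
  "noise_kernel \<phi> s = (LBINT u. \<phi> u * MA_coeff \<nu> (u - s))"

lemma noise_kernel_interval:
  assumes "x < y"
  shows "integrable lborel (\<lambda>u. indicator {x<..y} u * MA_coeff \<nu> (u - s))"
    and "(LBINT u. indicator {x<..y} u * MA_coeff \<nu> (u - s)) = MA_primitive \<nu> (y - s) - MA_primitive \<nu> (x - s)"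
proof -
  let ?f = "\<lambda>v. indicator {x - s..<y - s} v * MA_coeff \<nu> v"
  have i: "integrable lborel ?f"
    using assms by (intro MA_primitive_diff) auto
  have eq: "AE u in lborel. indicator {x<..y} u * MA_coeff \<nu> (u - s) = ?f (- s + 1 * u)"
    using AE_lborel_singleton[of x] AE_lborel_singleton[of y]
    by eventually_elim (auto simp: indicator_def)
  have i': "integrable lborel (\<lambda>u. ?f (- s + 1 * u))"
    by (rule lborel_integrable_real_affine[OF i]) simp
  show "integrable lborel (\<lambda>u. indicator {x<..y} u * MA_coeff \<nu> (u - s))"
    by (rule integrable_cong_AE_imp[OF i']) (use eq in auto)
  have "(LBINT u. indicator {x<..y} u * MA_coeff \<nu> (u - s)) = (LBINT u. ?f (- s + 1 * u))"
    by (rule integral_cong_AE) (use eq in auto)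
  also have "\<dots> = (LBINT v. ?f v)"
    using lborel_integral_real_affine[of 1 ?f "- s"] by simp
  also have "\<dots> = MA_primitive \<nu> (y - s) - MA_primitive \<nu> (x - s)"
    using assms by (intro MA_primitive_diff(2)[symmetric]) auto
  finally show "(LBINT u. indicator {x<..y} u * MA_coeff \<nu> (u - s)) = MA_primitive \<nu> (y - s) - MA_primitive \<nu> (x - s)" .
qed

lemma simple_integral_has_kernel:
  assumes "has_simple_integral X I \<phi> Z"
  shows "has_kernel Z (noise_kernel \<phi>)"
proof -
  obtain m t a where t: "\<forall>k<m. t k < t (Suc k)"
      and \<phi>: "\<phi> = (\<lambda>x. \<Sum>k<m. a k * indicator {t k<..t (Suc k)} x)"
      and Z: "Z = (\<lambda>\<omega>. \<Sum>k<m. a k * (X (t (Suc k)) \<omega> - X (t k) \<omega>))"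
    using assms(1) unfolding has_simple_integral_def by (elim exE conjE) (rule that)
  let ?k = "\<lambda>t s. MA_primitive \<nu> (t - s) - MA_primitive \<nu> (- s)"
  have "noise_kernel \<phi> s = (\<Sum>k<m. a k * (?k (t (Suc k)) s - ?k (t k) s))" for s
  proof -
    have "noise_kernel \<phi> s = (LBINT u. (\<Sum>k<m. a k * (indicator {t k<..t (Suc k)} u * MA_coeff \<nu> (u - s))))"
      unfolding noise_kernel_def \<phi> by (simp only: sum_distrib_right mult.assoc)
    also have "\<dots> = (\<Sum>k<m. a k * (LBINT u. indicator {t k<..t (Suc k)} u * MA_coeff \<nu> (u - s)))"
      using t noise_kernel_interval(1) by (subst Bochner_Integration.integral_sum) auto
    also have "\<dots> = (\<Sum>k<m. a k * (?k (t (Suc k)) s - ?k (t k) s))"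
      using t by (intro sum.cong) (auto simp: noise_kernel_interval(2))
    finally show ?thesis .
  qed
  then have "noise_kernel \<phi> = (\<lambda>s. \<Sum>k<m. a k * (?k (t (Suc k)) s - ?k (t k) s))" by auto
  then show ?thesis
    unfolding Z by (simp only:) (intro isometric_closure_sum isometric_closure_diff X_has_kernel)
qed

context
  fixes I :: "real set" and p :: "real \<Rightarrow> real"
  assumes I: "closed I" and p: "p \<in> H_space (MA_coeff \<nu>) I" and p_nonneg: "\<And>x. 0 \<le> p x"
begin

lemma indicator_times_integrand_measurable [measurable]: "(\<lambda>x. indicator I x * p x) \<in> borel_measurable borel"
  using p by (auto simp: H_space_def set_borel_measurable_def)

lemma noise_kernel_nn:
  "(\<integral>\<^sup>+u\<in>I. ennreal (\<bar>p u\<bar> * MA_coeff \<nu> (u - s)) \<partial>lborel)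
    = (\<integral>\<^sup>+u. ennreal ((indicator I u * p u) * MA_coeff \<nu> (u - s)) \<partial>lborel)"
  by (intro nn_integral_cong) (auto simp: indicator_def p_nonneg)

lemma noise_kernel_integrable:
  "AE s in lborel. integrable lborel (\<lambda>u. (indicator I u * p u) * MA_coeff \<nu> (u - s))"
proof -
  have "(\<integral>\<^sup>+s. (\<integral>\<^sup>+u\<in>I. ennreal (\<bar>p u\<bar> * MA_coeff \<nu> (u - s)) \<partial>lborel)\<^sup>2 \<partial>lborel) < \<infinity>"
    using p by (simp add: H_space_def)
  then have "AE s in lborel. (\<integral>\<^sup>+u. ennreal ((indicator I u * p u) * MA_coeff \<nu> (u - s)) \<partial>lborel)\<^sup>2 \<noteq> \<infinity>"
    unfolding noise_kernel_nn by (intro nn_integral_PInf_AE) auto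
  then show ?thesis
  proof eventually_elim
    case (elim s)
    then have "(\<integral>\<^sup>+u. ennreal ((indicator I u * p u) * MA_coeff \<nu> (u - s)) \<partial>lborel) < \<infinity>"
      by (auto simp: power_eq_top_ennreal less_top)
    then show ?case
      by (intro integrableI_nonneg) (auto simp: p_nonneg MA_coeff_nonneg)
  qed
qed

lemma noise_kernel_measurable: "noise_kernel (\<lambda>u. indicator I u * p u) \<in> borel_measurable lborel"
  unfolding noise_kernel_def by measurable

lemma noise_kernel_L2: "noise_kernel (\<lambda>u. indicator I u * p u) \<in> L2_functions lborel"
  unfolding L2_functions_def
proof (intro CollectI conjI noise_kernel_measurable integrableI_bounded)
  note [measurable] = noise_kernel_measurable
  show "(\<lambda>s. (noise_kernel (\<lambda>u. indicator I u * p u) s)\<^sup>2) \<in> borel_measurable lborel" by measurable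
  have "(\<integral>\<^sup>+s. ennreal (norm ((noise_kernel (\<lambda>u. indicator I u * p u) s)\<^sup>2)) \<partial>lborel)
      = (\<integral>\<^sup>+s. (\<integral>\<^sup>+u\<in>I. ennreal (\<bar>p u\<bar> * MA_coeff \<nu> (u - s)) \<partial>lborel)\<^sup>2 \<partial>lborel)"
  proof (rule nn_integral_cong_AE, use noise_kernel_integrable in eventually_elim)
    case (elim s)
    then have "ennreal (noise_kernel (\<lambda>u. indicator I u * p u) s) = (\<integral>\<^sup>+u\<in>I. ennreal (\<bar>p u\<bar> * MA_coeff \<nu> (u - s)) \<partial>lborel)"
      unfolding noise_kernel_nn noise_kernel_def
      by (intro nn_integral_eq_integral[symmetric]) (auto simp: p_nonneg MA_coeff_nonneg)
    moreover have "0 \<le> noise_kernel (\<lambda>u. indicator I u * p u) s"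
      unfolding noise_kernel_def by (intro integral_nonneg_AE AE_I2) (auto simp: p_nonneg MA_coeff_nonneg)
    ultimately show ?case by (simp add: ennreal_power[symmetric])
  qed
  also have "\<dots> < \<infinity>" using p by (simp add: H_space_def)
  finally show "(\<integral>\<^sup>+s. ennreal (norm ((noise_kernel (\<lambda>u. indicator I u * p u) s)\<^sup>2)) \<partial>lborel) < \<infinity>" .
qed

text \<open>
  Dominated convergence, twice: in \<open>u\<close> it gives convergence of the kernels at almost every \<open>s\<close>, and
  in \<open>s\<close>, where the square of the limiting kernel is a dominating function, convergence in \<open>L\<^sup>2\<close>.
\<close>

lemma simple_approx_noise_kernel_lim:
  assumes "simple_approx X I p \<phi> Z"
  shows "L2_lim lborel (\<lambda>n. noise_kernel (\<phi> n)) (noise_kernel (\<lambda>u. indicator I u * p u))"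
proof -
  have simple: "\<And>n. has_simple_integral X I (\<phi> n) (Z n)" and nonneg: "\<And>n x. 0 \<le> \<phi> n x"
    and AE_conv: "AE x in lborel. x \<in> I \<longrightarrow> incseq (\<lambda>n. \<phi> n x) \<and> (\<lambda>n. \<phi> n x) \<longlonglongrightarrow> p x"
    using assms by (auto simp: simple_approx_def)
  note [measurable] = simple_integral_measurable[OF simple]
  let ?P = "\<lambda>u. indicator I u * p u"
  have conv: "AE x in lborel. (\<forall>n. \<phi> n x \<le> ?P x) \<and> (\<lambda>n. \<phi> n x) \<longlonglongrightarrow> ?P x"
    using AE_conv
  proof eventually_elim
    case (elim x)
    then show ?case
      using incseq_le[of "\<lambda>n. \<phi> n x" "p x"] simple_integral_support[OF simple, of x]
      by (cases "x \<in> I") auto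
  qed
  have L2: "noise_kernel (\<phi> n) \<in> L2_functions lborel" for n
    using isometric_closure_L2[OF simple_integral_has_kernel[OF simple]] by simp
  note [measurable] = L2_functionsD(1)[OF L2] noise_kernel_measurable
  have lim: "AE s in lborel. (\<lambda>n. noise_kernel (\<phi> n) s) \<longlonglongrightarrow> noise_kernel ?P s \<and> (\<forall>n. 0 \<le> noise_kernel (\<phi> n) s \<and> noise_kernel (\<phi> n) s \<le> noise_kernel ?P s)"
    using noise_kernel_integrable
  proof eventually_elim
    case (elim s)
    have bound: "AE u in lborel. norm (\<phi> n u * MA_coeff \<nu> (u - s)) \<le> ?P u * MA_coeff \<nu> (u - s)" for n
      using conv by eventually_elim (auto simp: nonneg MA_coeff_nonneg abs_mult intro!: mult_right_mono)
    have "(\<lambda>n. noise_kernel (\<phi> n) s) \<longlonglongrightarrow> noise_kernel ?P s"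
      unfolding noise_kernel_def
    proof (rule integral_dominated_convergence[OF _ _ elim _ bound])
      show "AE u in lborel. (\<lambda>n. \<phi> n u * MA_coeff \<nu> (u - s)) \<longlonglongrightarrow> ?P u * MA_coeff \<nu> (u - s)"
        using conv by eventually_elim (auto intro!: tendsto_intros)
    qed measurable
    moreover have "0 \<le> noise_kernel (\<phi> n) s" for n
      unfolding noise_kernel_def by (intro integral_nonneg_AE AE_I2) (auto simp: nonneg MA_coeff_nonneg)
    moreover have "noise_kernel (\<phi> n) s \<le> noise_kernel ?P s" for n
    proof -
      have i: "integrable lborel (\<lambda>u. \<phi> n u * MA_coeff \<nu> (u - s))"
        by (rule Bochner_Integration.integrable_bound[OF elim]) (use bound[of n] in \<open>auto elim!: eventually_mono\<close>)
      show ?thesis unfolding noise_kernel_def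
        by (rule integral_mono_AE[OF i elim]) (use bound[of n] in \<open>auto elim!: eventually_mono\<close>)
    qed
    ultimately show ?case by blast
  qed
  have "(\<lambda>n. \<integral>s. (noise_kernel (\<phi> n) s - noise_kernel ?P s)\<^sup>2 \<partial>lborel) \<longlonglongrightarrow> (\<integral>s. 0 \<partial>(lborel :: real measure))"
  proof (rule integral_dominated_convergence)
    show "integrable lborel (\<lambda>s. (noise_kernel ?P s)\<^sup>2)"
      by (rule L2_functionsD(2)[OF noise_kernel_L2])
    show "AE s in lborel. (\<lambda>n. (noise_kernel (\<phi> n) s - noise_kernel ?P s)\<^sup>2) \<longlonglongrightarrow> 0"
      using lim by eventually_elim (auto intro!: tendsto_eq_intros)
    show "AE s in lborel. norm ((noise_kernel (\<phi> n) s - noise_kernel ?P s)\<^sup>2) \<le> (noise_kernel ?P s)\<^sup>2" for n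
      using lim
    proof eventually_elim
      case (elim s)
      then have "0 \<le> noise_kernel (\<phi> n) s" "noise_kernel (\<phi> n) s \<le> noise_kernel ?P s" by auto
      then have "\<bar>noise_kernel (\<phi> n) s - noise_kernel ?P s\<bar> \<le> \<bar>noise_kernel ?P s\<bar>" by simp
      then show ?case by (simp add: abs_le_square_iff)
    qed
  qed measurable
  then show ?thesis using L2 noise_kernel_L2 by (simp add: L2_lim_def)
qed

text \<open>
  The kernels converge, so the simple integrals do; any other approximating sequence has the same
  limiting kernel and therefore the same limit.
\<close>

lemma nonneg_integral_exists:
  assumes "\<exists>\<phi> Z. simple_approx X I p \<phi> Z"
  shows "\<exists>J. has_nonneg_integral M X I p J"
proof -
  have M: "prob_space M" using W by (simp add: brownian_motion_def)
  have k: "has_kernel (Z n) (noise_kernel (\<phi> n))" if "simple_approx X I p \<phi> Z" for \<phi> Z n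
    using that by (auto simp: simple_approx_def intro: simple_integral_has_kernel)
  obtain \<phi> Z where a: "simple_approx X I p \<phi> Z" using assms by blast
  obtain J where J: "L2_lim M Z J"
    using isometric_closure_lim_exists[OF M k[OF a] simple_approx_noise_kernel_lim[OF a]] by blast
  have "has_kernel J (noise_kernel (\<lambda>u. indicator I u * p u))"
    by (rule isometric_closure.lim[OF k[OF a] J simple_approx_noise_kernel_lim[OF a]])
  then have "L2_lim M Z' J" if "simple_approx X I p \<phi>' Z'" for \<phi>' Z'
    by (rule isometric_closure_lim_unique[OF k[OF that] simple_approx_noise_kernel_lim[OF that]])
  then show ?thesis using assms unfolding has_nonneg_integral_def by blast
qed

lemma nonneg_integral_has_kernel:
  assumes "has_nonneg_integral M X I p J"
  shows "has_kernel J (noise_kernel (\<lambda>u. indicator I u * p u))" "J \<in> closed_span M X I"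
proof -
  obtain \<phi> Z where a: "simple_approx X I p \<phi> Z" and J: "L2_lim M Z J"
    using assms by (auto simp: has_nonneg_integral_def)
  have simple: "has_simple_integral X I (\<phi> n) (Z n)" for n using a by (simp add: simple_approx_def)
  show "has_kernel J (noise_kernel (\<lambda>u. indicator I u * p u))"
    by (rule isometric_closure.lim[OF simple_integral_has_kernel[OF simple] J simple_approx_noise_kernel_lim[OF a]])
  show "J \<in> closed_span M X I"
    using J simple_integral_lin_span[OF simple I] by (auto simp: closed_span_def)
qed

end

end

section \<open>The prediction formula\<close>

locale prediction = convolution_unit_pair \<nu> \<mu> L + moving_average \<nu> M W X
  for \<nu> \<mu> L M W X +
  fixes t1 :: real
  assumes t1: "0 \<le> t1"
    and c_sq: "(\<integral>\<^sup>+t\<in>{1..}. ennreal ((c t)\<^sup>2) \<partial>lborel) < \<infinity>"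
begin

definition weight :: "real \<Rightarrow> real" where
  "weight s = integrated_b (t1 - s)"

lemma weight_nonneg: "s < t1 \<Longrightarrow> 0 \<le> weight s"
  unfolding weight_def by (rule ennreal_integrated_b) simp

lemma weight_mono: "mono_on {..<t1} weight"
  by (rule mono_onI) (auto simp: weight_def intro!: integrated_b_antimono)

lemma weight_measurable: "(\<lambda>s. indicator {..t1} s * weight s) \<in> borel_measurable borel"
proof -
  note [measurable] = integrated_b_measurable
  have "indicator {..t1} s * weight s = (indicator {0<..} (t1 - s) * integrated_b (t1 - s)) + indicator {t1} s * integrated_b 0" for s
    by (auto simp: weight_def indicator_def)
  moreover have "(\<lambda>s. indicator {0<..} (t1 - s) * integrated_b (t1 - s)) \<in> borel_measurable borel"
    by (rule measurable_compose[OF _ integrated_b_measurable]) simp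
  ultimately show ?thesis by simp
qed

text \<open>
  The substitution \<open>u = t1 - r\<close> turns the integral that defines \<open>H_space\<close> into a convolution. The
  endpoint \<open>u = t1\<close>, where the kernel \<open>b\<close> has no meaning, is a null set.
\<close>

lemma noise_kernel_weight_eq_conv:
  "(\<integral>\<^sup>+u\<in>{..t1}. ennreal (\<bar>weight u\<bar> * c (u - s)) \<partial>lborel) = conv integrated_b_ext C (t1 - s)"
proof -
  have "(\<integral>\<^sup>+u\<in>{..t1}. ennreal (\<bar>weight u\<bar> * c (u - s)) \<partial>lborel) = (\<integral>\<^sup>+u. integrated_b_ext (t1 - u) * C (u - s) \<partial>lborel)"
    using AE_lborel_singleton[of t1]
  proof (intro nn_integral_cong_AE, eventually_elim)
    case (elim u)
    show ?case
    proof (cases "u < t1")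
      case True
      then show ?thesis
        using ennreal_integrated_b[of "t1 - u"] by (simp add: weight_def ennreal_mult nu.MA_coeff_nonneg)
    qed (use elim in \<open>auto simp: integrated_b_ext_def indicator_def\<close>)
  qed
  also have "\<dots> = conv integrated_b_ext C (t1 - s)"
    unfolding conv_def
    by (subst nn_integral_real_affine[where c="-1" and t=t1]) (auto simp: algebra_simps)
  finally show ?thesis .
qed

lemma noise_kernel_weight_eq_AE:
  "AE s in lborel. (\<integral>\<^sup>+u\<in>{..t1}. ennreal (\<bar>weight u\<bar> * c (u - s)) \<partial>lborel)
     = ennreal (indicator {..<t1} s * (g (t1 + L - s) - g (t1 - s)))"
proof -
  have "AE s in lborel. 0 < t1 + (-1) * s \<longrightarrow> conv integrated_b_ext C (t1 + (-1) * s) = ennreal (g (t1 + (-1) * s + L) - g (t1 + (-1) * s))"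
    by (rule AE_borel_affine[OF _ _ conv_integrated_b_c]) auto
  then show ?thesis
  proof eventually_elim
    case (elim s)
    show ?case
    proof (cases "s < t1")
      case True
      then show ?thesis using elim unfolding noise_kernel_weight_eq_conv by (simp add: algebra_simps)
    next
      case False
      have "conv integrated_b_ext C (t1 - s) = (\<integral>\<^sup>+(r::real). 0 \<partial>lborel)"
        unfolding conv_def integrated_b_ext_def using False
        by (intro nn_integral_cong) (auto simp: indicator_def nu.MA_coeff_nonpos)
      then show ?thesis unfolding noise_kernel_weight_eq_conv using False by simp
    qed
  qed
qed

text \<open>
  By \<open>noise_kernel_weight_eq_AE\<close> the claim is that \<open>g (x + L) - g x\<close> is square integrable on the
  positive half-line. Near \<open>0\<close> it is bounded; for \<open>x \<ge> 1\<close> it is at most \<open>L c x\<close>, and \<open>c\<close> is square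
  integrable there.
\<close>

lemma weight_H_space: "weight \<in> H_space c {..t1}"
proof -
  let ?d = "\<lambda>x. g (x + L) - g x"
  have d0: "0 \<le> ?d x" for x using nu.MA_primitive_mono[of x "x + L"] L_pos by simp
  have bound: "ennreal ((?d x)\<^sup>2) * indicator {0<..} x
     \<le> ennreal ((g (1 + L))\<^sup>2) * indicator {0..1} x + ennreal (L\<^sup>2) * (ennreal ((c x)\<^sup>2) * indicator {1..} x)" for x
  proof -
    consider "x \<le> 0" | "0 < x" "x \<le> 1" | "1 < x" by linarith
    then show ?thesis
    proof cases
      case 2
      have "?d x \<le> g (1 + L)"
        using nu.MA_primitive_mono[of "x + L" "1 + L"] nu.MA_primitive_nonneg[of x] 2 by simp
      then have "(?d x)\<^sup>2 \<le> (g (1 + L))\<^sup>2" using d0 by (intro power_mono)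
      then have "ennreal ((?d x)\<^sup>2) \<le> ennreal ((g (1 + L))\<^sup>2)" by (rule ennreal_leI)
      then show ?thesis using 2 by (auto intro: add_increasing2)
    next
      case 3
      have "?d x \<le> L * c x" using 3 L_pos by (intro nu.MA_primitive_diff_le) auto
      then have "(?d x)\<^sup>2 \<le> (L * c x)\<^sup>2" using d0 by (intro power_mono)
      then have "ennreal ((?d x)\<^sup>2) \<le> ennreal (L\<^sup>2) * ennreal ((c x)\<^sup>2)"
        by (simp add: power_mult_distrib ennreal_leI flip: ennreal_mult)
      then show ?thesis using 3 by simp
    qed simp
  qed
  have "(\<integral>\<^sup>+s. (\<integral>\<^sup>+u\<in>{..t1}. ennreal (\<bar>weight u\<bar> * c (u - s)) \<partial>lborel)\<^sup>2 \<partial>lborel)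
      = (\<integral>\<^sup>+s. ennreal ((?d (t1 - s))\<^sup>2) * indicator {0<..} (t1 - s) \<partial>lborel)"
  proof (rule nn_integral_cong_AE, use noise_kernel_weight_eq_AE in eventually_elim)
    case (elim s)
    then show ?case
      unfolding elim using d0[of "t1 - s"] by (auto simp: indicator_def ennreal_power algebra_simps)
  qed
  also have "\<dots> = (\<integral>\<^sup>+x. ennreal ((?d x)\<^sup>2) * indicator {0<..} x \<partial>lborel)"
    by (subst (2) nn_integral_real_affine[where c="-1" and t=t1]) auto
  also have "\<dots> \<le> (\<integral>\<^sup>+x. ennreal ((g (1 + L))\<^sup>2) * indicator {0..1} x + ennreal (L\<^sup>2) * (ennreal ((c x)\<^sup>2) * indicator {1..} x) \<partial>lborel)"
    by (intro nn_integral_mono bound)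
  also have "\<dots> = ennreal ((g (1 + L))\<^sup>2) * (\<integral>\<^sup>+x. indicator {0..1::real} x \<partial>lborel)
      + ennreal (L\<^sup>2) * (\<integral>\<^sup>+x. ennreal ((c x)\<^sup>2) * indicator {1..} x \<partial>lborel)"
    by (simp add: nn_integral_add nn_integral_cmult)
  also have "\<dots> < \<infinity>" using c_sq by (simp add: ennreal_mult_less_top)
  finally have "(\<integral>\<^sup>+s. (\<integral>\<^sup>+u\<in>{..t1}. ennreal (\<bar>weight u\<bar> * c (u - s)) \<partial>lborel)\<^sup>2 \<partial>lborel) < \<infinity>" .
  moreover have "set_borel_measurable borel {..t1} weight"
    using weight_measurable by (simp add: set_borel_measurable_def)
  ultimately show ?thesis unfolding H_space_def by (intro CollectI conjI)
qed

abbreviation "weight_pos \<equiv> \<lambda>x. max (weight x) 0"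
abbreviation "weight_neg \<equiv> \<lambda>x. max (- weight x) 0"

lemma weight_pos_approx: "\<exists>\<phi> Z. simple_approx X {..t1} weight_pos \<phi> Z"
proof (rule step_approx_exists)
  show "mono_on {..<t1} weight_pos"
    by (intro mono_onI max.mono mono_onD[OF weight_mono]) auto
qed auto

text \<open>
  The negative part vanishes except possibly at \<open>t1\<close>, so the zero functions approximate it.
\<close>

lemma weight_neg_approx: "\<exists>\<phi> Z. simple_approx X {..t1} weight_neg \<phi> Z"
proof -
  have "has_simple_integral X {..t1} (\<lambda>_. 0) (\<lambda>_. 0)"
    unfolding has_simple_integral_def by (rule exI[of _ 0]) auto
  moreover have "AE x in lborel. x \<in> {..t1} \<longrightarrow> incseq (\<lambda>n::nat. 0::real) \<and> (\<lambda>n. 0) \<longlonglongrightarrow> weight_neg x"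
    using AE_lborel_singleton[of t1]
  proof eventually_elim
    case (elim x)
    then show ?case using weight_nonneg[of x] by (auto simp: max_def)
  qed
  ultimately have "simple_approx X {..t1} weight_neg (\<lambda>_ _. 0) (\<lambda>_ _. 0)"
    by (auto simp: simple_approx_def)
  then show ?thesis by blast
qed

lemma stochastic_integral_exists: "\<exists>J. has_stochastic_integral M X {..t1} weight J"
proof -
  obtain Jp where Jp: "has_nonneg_integral M X {..t1} weight_pos Jp"
    using nonneg_integral_exists[OF closed_atMost H_space_pos_neg_parts(1)[OF weight_H_space] max.cobounded2 weight_pos_approx] by (elim exE)
  obtain Jn where Jn: "has_nonneg_integral M X {..t1} weight_neg Jn"
    using nonneg_integral_exists[OF closed_atMost H_space_pos_neg_parts(2)[OF weight_H_space] max.cobounded2 weight_neg_approx] by (elim exE)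
  have "has_stochastic_integral M X {..t1} weight (\<lambda>\<omega>. Jp \<omega> - Jn \<omega>)"
    unfolding has_stochastic_integral_def
    by (rule exI[of _ Jp], rule exI[of _ Jn]) (intro conjI Jp Jn refl)
  then show ?thesis by (intro exI)
qed

lemma noise_kernel_weight_pos: "AE s in lborel. noise_kernel (\<lambda>u. indicator {..t1} u * weight_pos u) s
     = indicator {..<t1} s * (g (t1 + L - s) - g (t1 - s))"
  using noise_kernel_weight_eq_AE
proof eventually_elim
  case (elim s)
  note [measurable] = indicator_times_integrand_measurable[OF closed_atMost H_space_pos_neg_parts(1)[OF weight_H_space] max.cobounded2]
  have "noise_kernel (\<lambda>u. indicator {..t1} u * weight_pos u) s
      = enn2real (\<integral>\<^sup>+u. ennreal ((indicator {..t1} u * weight_pos u) * c (u - s)) \<partial>lborel)"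
    unfolding noise_kernel_def
    by (intro integral_eq_nn_integral) (auto simp: nu.MA_coeff_nonneg)
  also have "(\<integral>\<^sup>+u. ennreal ((indicator {..t1} u * weight_pos u) * c (u - s)) \<partial>lborel)
      = (\<integral>\<^sup>+u\<in>{..t1}. ennreal (\<bar>weight u\<bar> * c (u - s)) \<partial>lborel)"
    using AE_lborel_singleton[of t1]
  proof (intro nn_integral_cong_AE, eventually_elim)
    case (elim u)
    then show ?case using weight_nonneg[of u] by (auto simp: indicator_def)
  qed
  also note elim
  also have "enn2real (ennreal (indicator {..<t1} s * (g (t1 + L - s) - g (t1 - s))))
      = indicator {..<t1} s * (g (t1 + L - s) - g (t1 - s))"
    using nu.MA_primitive_mono[of "t1 - s" "t1 + L - s"] L_pos by (simp add: indicator_def)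
  finally show ?case .
qed

lemma noise_kernel_weight_neg: "noise_kernel (\<lambda>u. indicator {..t1} u * weight_neg u) s = 0"
  unfolding noise_kernel_def
proof (rule integral_eq_zero_AE, use AE_lborel_singleton[of t1] in eventually_elim)
  case (elim u)
  then show ?case using weight_nonneg[of u] by (auto simp: indicator_def)
qed

text \<open>
  The prediction error has a kernel \<open>d\<close> that vanishes below \<open>t1\<close>, whereas the kernel of \<open>X t\<close> with
  \<open>t \<le> t1\<close> vanishes above \<open>t1\<close>, as \<open>0 \<le> t1\<close>. So the error is orthogonal to every such \<open>X t\<close>, and by
  continuity of the inner product to their closed span.
\<close>

lemma projection:
  assumes J: "has_stochastic_integral M X {..t1} weight J"
  shows "is_projection M X {..t1} (X (t1 + L)) (\<lambda>\<omega>. X t1 \<omega> + J \<omega>)"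
proof -
  let ?k = "\<lambda>t s. g (t - s) - g (- s)"
  obtain Jp Jn where Jp: "has_nonneg_integral M X {..t1} weight_pos Jp"
    and Jn: "has_nonneg_integral M X {..t1} weight_neg Jn" and J_eq: "J = (\<lambda>\<omega>. Jp \<omega> - Jn \<omega>)"
    using J unfolding has_stochastic_integral_def by (elim exE conjE)
  have p: "has_kernel Jp (noise_kernel (\<lambda>u. indicator {..t1} u * weight_pos u))" "Jp \<in> closed_span M X {..t1}"
    by (rule nonneg_integral_has_kernel[OF closed_atMost H_space_pos_neg_parts(1)[OF weight_H_space] max.cobounded2 Jp])+
  have n: "has_kernel Jn (noise_kernel (\<lambda>u. indicator {..t1} u * weight_neg u))" "Jn \<in> closed_span M X {..t1}"
    by (rule nonneg_integral_has_kernel[OF closed_atMost H_space_pos_neg_parts(2)[OF weight_H_space] max.cobounded2 Jn])+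
  define D where "D \<omega> = (X (t1 + L) \<omega> - X t1 \<omega>) - (Jp \<omega> - Jn \<omega>)" for \<omega>
  define d where "d s = (?k (t1 + L) s - ?k t1 s)
    - (noise_kernel (\<lambda>u. indicator {..t1} u * weight_pos u) s - noise_kernel (\<lambda>u. indicator {..t1} u * weight_neg u) s)" for s
  have D: "has_kernel D d"
    unfolding D_def d_def by (intro isometric_closure_diff X_has_kernel p n)
  have d0: "AE s in lborel. s < t1 \<longrightarrow> d s = 0"
    using noise_kernel_weight_pos by eventually_elim (simp add: d_def noise_kernel_weight_neg)
  have orth_X: "(\<integral>\<omega>. X t \<omega> * D \<omega> \<partial>M) = 0" if "t \<le> t1" for t
  proof -
    have "(\<integral>\<omega>. X t \<omega> * D \<omega> \<partial>M) = (\<integral>s. ?k t s * d s \<partial>lborel)"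
      by (rule isometric_closure_inner[OF X_has_kernel D])
    also have "\<dots> = 0"
    proof (rule integral_eq_zero_AE, use d0 in eventually_elim)
      case (elim s)
      then show ?case using that t1 by (cases "s < t1") (auto simp: nu.MA_primitive_nonpos)
    qed
    finally show ?thesis .
  qed
  have D_L2: "D \<in> L2_functions M" using isometric_closure_L2[OF D] by simp
  have orth_span: "(\<integral>\<omega>. F \<omega> * D \<omega> \<partial>M) = 0" if F: "F \<in> lin_span X {..t1}" for F
  proof -
    obtain S a where S: "finite S" "S \<subseteq> {..t1}" "F = (\<lambda>\<omega>. \<Sum>t\<in>S. a t * X t \<omega>)"
      using F by (auto simp: lin_span_def)
    have "(\<integral>\<omega>. F \<omega> * D \<omega> \<partial>M) = (\<integral>\<omega>. (\<Sum>t\<in>S. a t * (X t \<omega> * D \<omega>)) \<partial>M)"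
      by (simp add: S(3) sum_distrib_right mult.assoc)
    also have "\<dots> = (\<Sum>t\<in>S. a t * (\<integral>\<omega>. X t \<omega> * D \<omega> \<partial>M))"
      by (subst Bochner_Integration.integral_sum) (auto intro!: L2_mult_integrable X_L2 D_L2)
    also have "\<dots> = 0" using S(2) orth_X by (intro sum.neutral) auto
    finally show ?thesis .
  qed
  have orth: "(\<integral>\<omega>. V \<omega> * D \<omega> \<partial>M) = 0" if V: "V \<in> closed_span M X {..t1}" for V
  proof -
    obtain F where F: "\<And>n. F n \<in> lin_span X {..t1}" "L2_lim M F V"
      using V by (auto simp: closed_span_def)
    have "(\<lambda>n. \<integral>\<omega>. F n \<omega> * D \<omega> \<partial>M) \<longlonglongrightarrow> (\<integral>\<omega>. V \<omega> * D \<omega> \<partial>M)"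
      by (rule L2_lim_inner[OF F(2) D_L2])
    then have "(\<lambda>n. 0) \<longlonglongrightarrow> (\<integral>\<omega>. V \<omega> * D \<omega> \<partial>M)"
      by (simp add: orth_span[OF F(1)])
    then show ?thesis by (simp add: LIMSEQ_const_iff)
  qed
  have "X (t1 + L) \<in> closed_span M X UNIV"
    by (rule closed_span_base) (auto intro: X_L2)
  moreover have "(\<lambda>\<omega>. X t1 \<omega> + J \<omega>) \<in> closed_span M X {..t1}"
  proof -
    have "(\<lambda>\<omega>. (X t1 \<omega> + 1 * Jp \<omega>) + (-1) * Jn \<omega>) \<in> closed_span M X {..t1}"
      by (intro closed_span_add_scaled p n closed_span_base X_L2) auto
    then show ?thesis by (simp add: J_eq algebra_simps)
  qed
  moreover have "(\<integral>\<omega>. (X (t1 + L) \<omega> - (X t1 \<omega> + J \<omega>)) * V \<omega> \<partial>M) = 0" if "V \<in> closed_span M X {..t1}" for V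
    using orth[OF that] by (simp add: D_def J_eq algebra_simps)
  ultimately show ?thesis by (simp add: is_projection_def)
qed

end

theorem theorem3p8:
  fixes M :: "'w measure" and W X :: "real \<Rightarrow> 'w \<Rightarrow> real"
    and \<nu> \<mu> :: "real measure" and t1 T :: real
  assumes W: "brownian_motion M W"
    and nu: "borel_measure_on_pos \<nu>"
    and nu_fin: "(\<integral>\<^sup>+s. ennreal (1 / (1 + s)) \<partial>\<nu>) < \<infinity>"
    and c_0: "filterlim (MA_coeff \<nu>) at_top (at_right 0)"
    and c_sq: "(\<integral>\<^sup>+t\<in>{1..}. ennreal ((MA_coeff \<nu> t)\<^sup>2) \<partial>lborel) < \<infinity>"
    and g_inf: "filterlim (MA_primitive \<nu>) at_top at_top"
    and X: "\<And>t. has_wiener_integral M W (\<lambda>s. MA_primitive \<nu> (t - s) - MA_primitive \<nu> (- s)) (X t)"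
    and mu: "AR_measure \<nu> \<mu>"
    and t1: "0 \<le> t1" and T: "t1 < T"
  defines "f \<equiv> \<lambda>s. LBINT \<tau>:{0<..<T - t1}. kernel_b \<nu> \<mu> (t1 - s) \<tau>"
  shows "f \<in> H_space (MA_coeff \<nu>) {..t1} \<and>
    (\<exists>J. has_stochastic_integral M X {..t1} f J) \<and>
    (\<forall>J. has_stochastic_integral M X {..t1} f J \<longrightarrow>
       is_projection M X {..t1} (X T) (\<lambda>\<omega>. X t1 \<omega> + J \<omega>))"
proof -
  have l\<nu>: "laplace_measure \<nu>" using nu nu_fin by unfold_locales
  have l\<mu>: "laplace_measure \<mu>" using mu by unfold_locales (auto simp: AR_measure_def)
  have alpha: "(LBINT t:{0<..}. exp (\<i> * z * of_real t) * complex_of_real (AR_alpha \<mu> t))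
      = (LBINT t:{0<..}. exp (\<i> * z * of_real t) * complex_of_real (MA_coeff \<mu> t))" for z
    by (rule set_lebesgue_integral_cong) (simp_all add: laplace_measure.AR_alpha_eq[OF l\<mu>])
  have transform: "- \<i> * z * (LBINT t:{0<..}. exp (\<i> * z * of_real t) * complex_of_real (MA_coeff \<nu> t))
      * (LBINT t:{0<..}. exp (\<i> * z * of_real t) * complex_of_real (MA_coeff \<mu> t)) = 1" if "0 < Im z" for z
    using mu that unfolding AR_measure_def alpha by blast
  note conv = laplace_convolution_eq_1[OF l\<nu> l\<mu> transform]
  interpret prediction \<nu> \<mu> "T - t1" M W X t1
    using T t1 by (intro prediction.intro convolution_unit_pair.intro moving_average.intro l\<nu> l\<mu>
        convolution_unit_pair_axioms.intro moving_average_axioms.intro prediction_axioms.intro W X conv c_sq) simp_all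
  have "f = weight"
    by (simp add: f_def fun_eq_iff weight_def integrated_b_def)
  then show ?thesis
    using weight_H_space stochastic_integral_exists projection by simp
qed

end
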